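(* Let $F:\mathbb{R}^n\times\mathbb{R}_{\ge0}^p\times\mathbb{R}^m\to\mathbb{R}$ be defined as $$F(x,y,z)=f(x)+y^\top g(x)+z^\top(Ax-b),$$ where $f:\mathbb{R}^n\to\mathbb{R}$ is strongly convex and twice continuously differentiable, $g:\mathbb{R}^n\to\mathbb{R}^p$ is convex (componentwise) and twice continuously differentiable, $A\in\mathbb{R}^{m\times n}$ and $b\in\mathbb{R}^m$, and assume the set $\mathrm{Saddle}(F)$ of saddle points of $F$ is non-empty. For each $(x,y,z)\in\mathbb{R}^n\times\mathbb{R}_{\ge0}^p\times\mathbb{R}^m$ define the index set $$\mathcal{J}(x,y,z)=\{j\in\{1,\dots,p\}\;|\;y_j=0\text{ and }(\nabla_yF(x,y,z))_j<0\}.$$ Then the function $V_2:\mathbb{R}^n\times\mathbb{R}_{\ge0}^p\times\mathbb{R}^m\to\mathbb{R}$, $$V_2(x,y,z)=\frac12\Bigl(\|\nabla_xF(x,y,z)\|^2+\|\nabla_zF(x,y,z)\|^2+\sum_{j\in\{1,\dots,p\}\setminus\mathcal{J}(x,y,z)}((\nabla_yF(x,y,z))_j)^2\Bigr)+\frac12\|(x,y,z)\|_{\mathrm{Saddle}(F)}^2,$$ is nonnegative everywhere in its domain, and $V_2(x,y,z)=0$ if and only if $(x,y,z)\in\mathrm{Saddle}(F)$. Moreover, for any trajectory $t\mapsto(x(t),y(t),z(t))$ of the projected saddle-point dynamics $$\dot x=-\nabla_xF(x,y,z),\qquad \dot y=[\nabla_yF(x,y,z)]_y^+,\qquad \dot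 z=\nabla_zF(x,y,z),$$ the map $t\mapsto V_2(x(t),y(t),z(t))$ (i) is differentiable almost everywhere and, if $(x(t),y(t),z(t))\notin\mathrm{Saddle}(F)$ for some $t\ge0$, then $\frac{d}{dt}V_2(x(t),y(t),z(t))<0$ provided the derivative exists. Furthermore, for any such $t$ and any sequence of times $\{t_k\}_{k=1}^\infty$ such that $t_k\to t$ and $\frac{d}{dt}V_2(x(t_k),y(t_k),z(t_k))$ exists for every $t_k$, we have $\limsup_{k\to\infty}\frac{d}{dt}V_2(x(t_k),y(t_k),z(t_k))<0$; (ii) is right-continuous and, at any point of discontinuity $t'\ge0$, $V_2(x(t'),y(t'),z(t'))\le\lim_{t\uparrow t'}V_2(x(t),y(t),z(t))$. As a consequence, $\mathrm{Saddle}(F)$ is globally asymptotically stable under the projected saddle-point dynamics, and convergence of trajectories is to a point.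
   Context: For $a\in\mathbb{R}$ and $b\ge 0$, $[a]_b^+=a$ if $b>0$ and $[a]_b^+=\max\{0,a\}$ if $b=0$; for vectors $a\in\mathbb{R}^p$, $b\in\mathbb{R}_{\ge0}^p$, $[a]_b^+$ is the vector with components $[a_i]_{b_i}^+$. $\|\cdot\|$ is the Euclidean norm and $\|w\|_{\mathcal{S}}=\inf_{v\in\mathcal{S}}\|w-v\|$ is the distance from $w$ to the set $\mathcal{S}$. A twice differentiable $f$ is strongly convex if $\nabla^2f(x)\succeq cI$ for all $x$, for some constant $c>0$. A point $(x_*,y_*,z_* )\in\mathbb{R}^n\times\mathbb{R}_{\ge0}^p\times\mathbb{R}^m$ is a saddle point of $F$ if $F(x_*,y,z)\le F(x_*,y_*,z_* )\le F(x,y_*,z_* )$ for all $x\in\mathbb{R}^n$ and $(y,z)\in\mathbb{R}_{\ge0}^p\times\mathbb{R}^m$. Trajectories are Caratheodory solutions on $[0,\infty)$: absolutely continuous maps (with values in $\mathbb{R}^n\times\mathbb{R}_{\ge0}^p\times\mathbb{R}^m$) satisfying the differential equation almost everywhere. Global asymptotic stability is relative to the domain $\mathbb{R}^n\times\mathbb{R}_{\ge0}^p\times\mathbb{R}^m$. "Convergence to a point" means each trajectory converges to some single point of $\mathrm{Saddle}(F)$ (which may depend on the trajectory). *)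

theory Defs
  imports "HOL-Analysis.Analysis"
begin

definition gradient :: "('a::real_inner \<Rightarrow> real) \<Rightarrow> 'a \<Rightarrow> 'a" where
  "gradient h x = (THE D. GDERIV h x :> D)"

definition hessian :: "(real ^ 'n \<Rightarrow> real) \<Rightarrow> real ^ 'n \<Rightarrow> real ^ 'n ^ 'n" where
  "hessian h x = matrix (frechet_derivative (gradient h) (at x))"

definition twice_continuously_differentiable ::
    "('a::real_normed_vector \<Rightarrow> 'b::real_normed_vector) \<Rightarrow> bool" where
  "twice_continuously_differentiable h \<longleftrightarrow>
     (\<exists>(h' :: 'a \<Rightarrow> 'a \<Rightarrow>\<^sub>L 'b) (h'' :: 'a \<Rightarrow> 'a \<Rightarrow>\<^sub>L ('a \<Rightarrow>\<^sub>L 'b)).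
        (\<forall>x. (h has_derivative blinfun_apply (h' x)) (at x)) \<and>
        (\<forall>x. (h' has_derivative blinfun_apply (h'' x)) (at x)) \<and>
        continuous_on UNIV h'')"

definition loewner_le :: "real ^ 'n ^ 'n \<Rightarrow> real ^ 'n ^ 'n \<Rightarrow> bool" where
  "loewner_le M N \<longleftrightarrow> (\<forall>v. v \<bullet> (M *v v) \<le> v \<bullet> (N *v v))"

text \<open>Meant for twice differentiable functions only: the Hessian is unspecified elsewhere.\<close>

definition strongly_convex :: "(real ^ 'n \<Rightarrow> real) \<Rightarrow> bool" where
  "strongly_convex h \<longleftrightarrow> (\<exists>c>0. \<forall>x. loewner_le (mat c) (hessian h x))"

text \<open>Absolute continuity of a curve on a compact interval. The cells of a division are
  non-empty compact intervals with disjoint interiors, whose endpoints are \<open>Inf K\<close> and \<open>Sup K\<close>.\<close>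

definition absolutely_continuous_on_interval ::
    "real \<Rightarrow> real \<Rightarrow> (real \<Rightarrow> 'a::real_normed_vector) \<Rightarrow> bool" where
  "absolutely_continuous_on_interval a b w \<longleftrightarrow>
     (\<forall>\<epsilon>>0. \<exists>\<delta>>0. \<forall>\<D> S. \<D> division_of S \<and> S \<subseteq> {a..b} \<and> (\<Sum>K\<in>\<D>. Sup K - Inf K) < \<delta> \<longrightarrow>
        (\<Sum>K\<in>\<D>. norm (w (Sup K) - w (Inf K))) < \<epsilon>)"

text \<open>Points are triples in a product type, whose norm and distance are the Euclidean ones.\<close>

definition state_space :: "((real ^ 'n) \<times> (real ^ 'p) \<times> (real ^ 'm)) set" where
  "state_space = {(x, y, z). \<forall>j. 0 \<le> y $ j}"

text \<open>The formula is used on the whole space, which extends the function on \<^const>\<open>state_space\<close>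
  and gives a meaning to the gradient in \<open>y\<close> on the boundary of the orthant.\<close>

definition lagrangian ::
    "(real ^ 'n \<Rightarrow> real) \<Rightarrow> (real ^ 'n \<Rightarrow> real ^ 'p) \<Rightarrow> real ^ 'n ^ 'm \<Rightarrow> real ^ 'm \<Rightarrow>
     (real ^ 'n) \<times> (real ^ 'p) \<times> (real ^ 'm) \<Rightarrow> real" where
  "lagrangian f g A b = (\<lambda>(x, y, z). f x + y \<bullet> g x + z \<bullet> (A *v x - b))"

definition Saddle ::
    "((real ^ 'n) \<times> (real ^ 'p) \<times> (real ^ 'm) \<Rightarrow> real) \<Rightarrow> ((real ^ 'n) \<times> (real ^ 'p) \<times> (real ^ 'm)) set" where
  "Saddle F = {(xs, ys, zs). (xs, ys, zs) \<in> state_space \<and>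
     (\<forall>x y z. (x, y, z) \<in> state_space \<longrightarrow>
        F (xs, y, z) \<le> F (xs, ys, zs) \<and> F (xs, ys, zs) \<le> F (x, ys, zs))}"

definition grad_x ::
    "((real ^ 'n) \<times> (real ^ 'p) \<times> (real ^ 'm) \<Rightarrow> real) \<Rightarrow> (real ^ 'n) \<times> (real ^ 'p) \<times> (real ^ 'm) \<Rightarrow> real ^ 'n" where
  "grad_x F = (\<lambda>(x, y, z). gradient (\<lambda>x'. F (x', y, z)) x)"

definition grad_y ::
    "((real ^ 'n) \<times> (real ^ 'p) \<times> (real ^ 'm) \<Rightarrow> real) \<Rightarrow> (real ^ 'n) \<times> (real ^ 'p) \<times> (real ^ 'm) \<Rightarrow> real ^ 'p" where
  "grad_y F = (\<lambda>(x, y, z). gradient (\<lambda>y'. F (x, y', z)) y)"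

definition grad_z ::
    "((real ^ 'n) \<times> (real ^ 'p) \<times> (real ^ 'm) \<Rightarrow> real) \<Rightarrow> (real ^ 'n) \<times> (real ^ 'p) \<times> (real ^ 'm) \<Rightarrow> real ^ 'm" where
  "grad_z F = (\<lambda>(x, y, z). gradient (\<lambda>z'. F (x, y, z')) z)"

definition proj_plus :: "real \<Rightarrow> real \<Rightarrow> real" where
  "proj_plus a b = (if b > 0 then a else max 0 a)"

definition proj_plus_vec :: "real ^ 'p \<Rightarrow> real ^ 'p \<Rightarrow> real ^ 'p" where
  "proj_plus_vec a b = (\<chi> j. proj_plus (a $ j) (b $ j))"

definition saddle_field ::
    "((real ^ 'n) \<times> (real ^ 'p) \<times> (real ^ 'm) \<Rightarrow> real) \<Rightarrow>
     (real ^ 'n) \<times> (real ^ 'p) \<times> (real ^ 'm) \<Rightarrow> (real ^ 'n) \<times> (real ^ 'p) \<times> (real ^ 'm)" where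
  "saddle_field F = (\<lambda>(x, y, z).
     (- grad_x F (x, y, z), proj_plus_vec (grad_y F (x, y, z)) y, grad_z F (x, y, z)))"

text \<open>Caratheodory solutions on \<open>[0, \<infinity>)\<close>, absolutely continuous on each compact subinterval.
  Values at negative times are irrelevant.\<close>

definition saddle_trajectory ::
    "((real ^ 'n) \<times> (real ^ 'p) \<times> (real ^ 'm) \<Rightarrow> real) \<Rightarrow>
     (real \<Rightarrow> (real ^ 'n) \<times> (real ^ 'p) \<times> (real ^ 'm)) \<Rightarrow> bool" where
  "saddle_trajectory F w \<longleftrightarrow>
     (\<forall>t\<ge>0. w t \<in> state_space) \<and>
     (\<forall>T\<ge>0. absolutely_continuous_on_interval 0 T w) \<and>
     (AE t in lebesgue_on {0..}. (w has_vector_derivative saddle_field F (w t)) (at t within {0..}))"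

definition index_set ::
    "((real ^ 'n) \<times> (real ^ 'p) \<times> (real ^ 'm) \<Rightarrow> real) \<Rightarrow> (real ^ 'n) \<times> (real ^ 'p) \<times> (real ^ 'm) \<Rightarrow> 'p set" where
  "index_set F = (\<lambda>(x, y, z). {j. y $ j = 0 \<and> grad_y F (x, y, z) $ j < 0})"

definition V2 ::
    "((real ^ 'n) \<times> (real ^ 'p) \<times> (real ^ 'm) \<Rightarrow> real) \<Rightarrow> (real ^ 'n) \<times> (real ^ 'p) \<times> (real ^ 'm) \<Rightarrow> real" where
  "V2 F w = 1 / 2 * ((norm (grad_x F w))\<^sup>2 + (norm (grad_z F w))\<^sup>2
                 + (\<Sum>j\<in>UNIV - index_set F w. (grad_y F w $ j)\<^sup>2))
            + 1 / 2 * (infdist w (Saddle F))\<^sup>2"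

text \<open>\<open>\<T>\<close> is the set of all trajectories \<open>[0, \<infinity>) \<rightarrow> D\<close> of the dynamics on its domain \<open>D\<close>; all
  notions are thus relative to \<open>D\<close>. Neighbourhoods of a (possibly unbounded) set are those given
  by the distance to it.\<close>

definition stable_set :: "(real \<Rightarrow> 'a::metric_space) set \<Rightarrow> 'a set \<Rightarrow> bool" where
  "stable_set \<T> S \<longleftrightarrow>
     (\<forall>\<epsilon>>0. \<exists>\<delta>>0. \<forall>w\<in>\<T>. infdist (w 0) S < \<delta> \<longrightarrow> (\<forall>t\<ge>0. infdist (w t) S < \<epsilon>))"

definition globally_attractive :: "(real \<Rightarrow> 'a::metric_space) set \<Rightarrow> 'a set \<Rightarrow> bool" where
  "globally_attractive \<T> S \<longleftrightarrow> (\<forall>w\<in>\<T>. ((\<lambda>t. infdist (w t) S) \<longlongrightarrow> 0) at_top)"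

definition globally_asymptotically_stable :: "(real \<Rightarrow> 'a::metric_space) set \<Rightarrow> 'a set \<Rightarrow> bool" where
  "globally_asymptotically_stable \<T> S \<longleftrightarrow> stable_set \<T> S \<and> globally_attractive \<T> S"

end

theory Submission
  imports Defs
begin

text \<open>
  The function \<^const>\<open>V2\<close> is the sum of two quantities which both decrease along the flow.

  The first is half the squared speed of the projected field, because the coordinates \<open>y\<^sub>j\<close> left
  out of the sum are exactly those at which the projection stops the motion. While that index set is
  constant, the couplings between the \<open>x\<close>-equation and the multiplier equations are skew and cancel,
  and what remains of the derivative is \<open>- v \<bullet> H v\<close>, where \<open>v\<close> is the gradient in \<open>x\<close> and \<open>H\<close> is the Hessian
  of the Lagrangian in \<open>x\<close>. As \<open>y \<ge> 0\<close>, \<open>H\<close> inherits the strong convexity constant \<open>c\<close> of \<open>f\<close>. The second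
  is half the squared distance to the closed convex set of saddle points. Its gradient at \<open>w\<close> is
  \<open>w - q\<close>, with \<open>q\<close> the nearest saddle point, and convexity in \<open>x\<close> with concavity in \<open>(y, z)\<close> makes
  the field point towards every saddle point (\<open>saddle_field_dissipative\<close>). All saddle points have the
  same \<open>x\<close>-component \<open>x\<^sub>*\<close>, so the two estimates add up to the bound
  \<open>decay (x, y, z) = - c \<bar>v\<bar>\<^sup>2 - c \<bar>x - x\<^sub>*\<bar>\<^sup>2 + y \<bullet> g x\<^sub>*\<close> of the derivative
  (\<open>V2_has_derivative_le_decay\<close>). By the KKT conditions this expression is nonpositive on the domain
  and vanishes exactly at the saddle points; as it is also continuous, it settles the claim on the
  limes superior of the derivatives.

  Regularity comes from the scalar equations for the \<open>y\<^sub>j\<close>. An absolutely continuous solution satisfies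
  the integral equation, and since the projected field is right-continuous along it, it has a right
  derivative at every time. The left derivative fails to agree only when \<open>y\<^sub>j\<close> reaches \<open>0\<close> at a time at which
  \<open>g\<^sub>j < 0\<close>. At that time \<open>j\<close> leaves the sum and stays out of it on a right neighbourhood, so
  \<^const>\<open>V2\<close> jumps downwards from the left and is right-continuous (\<open>active_square_has_derivative\<close>,
  \<open>active_square_left_limit\<close>).

  A function with bounded right derivatives and only downward jumps obeys the mean value inequality
  (\<open>growth_bound_right_derivative\<close>). Applied to \<open>\<bar>w - q\<bar>\<^sup>2\<close> it gives that the distance to each saddle
  point never increases, which is stability. Applied to \<^const>\<open>V2\<close>, which is bounded below, it gives
  times \<open>t\<^sub>k \<rightarrow> \<infinity>\<close> at which \<open>decay\<close> tends to \<open>0\<close>. A limit point of the bounded sequence \<open>w t\<^sub>k\<close> is then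
  a saddle point, and since the distance to it never increases, the whole trajectory converges to it.
\<close>

section \<open>Absolutely continuous curves\<close>

text \<open>Riemann sums over a fine tagged division telescope to \<open>w b - w a\<close> up to two errors. Cells tagged at
  a point of differentiability are controlled by the derivative. Cells tagged in the null set lie
  in an open set of small measure, so absolute continuity makes their total increment small.\<close>

lemma absolutely_continuous_fundamental_theorem:
  fixes w :: "real \<Rightarrow> 'a::real_normed_vector"
  assumes ac: "absolutely_continuous_on_interval a b w"
    and "a \<le> b" and N: "negligible N"
    and deriv: "\<And>t. t \<in> {a..b} - N \<Longrightarrow> (w has_vector_derivative w' t) (at t within {a..b})"
  shows "(w' has_integral (w b - w a)) {a..b}"
proof -
  let ?w' = "\<lambda>t. if t \<in> N then 0 else w' t"
  have "(?w' has_integral (w b - w a)) {a..b}"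
    unfolding has_integral_real
  proof (intro allI impI)
    fix e :: real
    assume "e > 0"
    \<comment> \<open>the extra \<open>1\<close> keeps the denominator positive when \<open>a = b\<close>\<close>
    define \<eta> where "\<eta> = e / (2 * (b - a + 1))"
    have \<eta>: "\<eta> > 0" "\<eta> * (b - a) < e / 2"
      using \<open>e > 0\<close> \<open>a \<le> b\<close> by (auto simp: \<eta>_def field_simps)
    obtain \<delta> where "\<delta> > 0" and \<delta>: "\<And>\<D> S. \<lbrakk>\<D> division_of S; S \<subseteq> {a..b}; (\<Sum>K\<in>\<D>. Sup K - Inf K) < \<delta>\<rbrakk>
        \<Longrightarrow> (\<Sum>K\<in>\<D>. norm (w (Sup K) - w (Inf K))) < e / 2"
      using ac \<open>e > 0\<close> unfolding absolutely_continuous_on_interval_def by (meson half_gt_zero)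
    have "N \<in> sets lebesgue" "measure lebesgue N = 0"
      using N negligible_imp_sets negligible_imp_measure0 by auto
    then obtain G where G: "open G" "N \<subseteq> G" "G - N \<in> lmeasurable" "emeasure lebesgue (G - N) < ennreal \<delta>"
      using sets_lebesgue_outer_open[of N \<delta>] \<open>\<delta> > 0\<close> by metis
    have Gm: "G \<in> lmeasurable" "measure lebesgue G < \<delta>"
    proof -
      have "N \<in> lmeasurable" using N by (rule negligible_imp_measurable)
      then have "(G - N) \<union> N \<in> lmeasurable" using G(3) by blast
      then show 1: "G \<in> lmeasurable" using G(2) by (simp add: Un_absorb2)
      have "measure lebesgue G = measure lebesgue (G - N)"
        using measure_Diff_null_set[of G lebesgue N] N 1 by (simp add: negligible_iff_null_sets fmeasurableD)
      then show "measure lebesgue G < \<delta>"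
        using G(3,4) by (simp add: emeasure_eq_measure2 ennreal_less_iff)
    qed
    have "\<exists>d>0. (t \<in> N \<longrightarrow> ball t d \<subseteq> G) \<and> (t \<in> {a..b} - N \<longrightarrow>
        (\<forall>s\<in>{a..b}. norm (s - t) < d \<longrightarrow> norm (w s - w t - (s - t) *\<^sub>R w' t) \<le> \<eta> * norm (s - t)))" for t
    proof (cases "t \<in> N")
      case True
      then obtain d where "d > 0" "ball t d \<subseteq> G" using G(1,2) openE[of G t] by blast
      then show ?thesis using True by blast
    next
      case False
      show ?thesis
      proof (cases "t \<in> {a..b}")
        case True
        then obtain d where "d > 0" "\<forall>s\<in>{a..b}. norm (s - t) < d \<longrightarrow>
            norm (w s - w t - (s - t) *\<^sub>R w' t) \<le> \<eta> * norm (s - t)"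
          using deriv[of t] \<open>t \<notin> N\<close> \<eta>(1) unfolding has_vector_derivative_def has_derivative_within_alt by blast
        then show ?thesis using \<open>t \<notin> N\<close> by blast
      next
        case False
        then show ?thesis using \<open>t \<notin> N\<close> zero_less_one by blast
      qed
    qed
    then obtain d where d: "\<And>t. d t > 0" "\<And>t. t \<in> N \<Longrightarrow> ball t (d t) \<subseteq> G"
      "\<And>t s. \<lbrakk>t \<in> {a..b} - N; s \<in> {a..b}; norm (s - t) < d t\<rbrakk>
         \<Longrightarrow> norm (w s - w t - (s - t) *\<^sub>R w' t) \<le> \<eta> * norm (s - t)"
      by metis
    show "\<exists>\<gamma>. gauge \<gamma> \<and> (\<forall>p. p tagged_division_of {a..b} \<and> \<gamma> fine p \<longrightarrow>
             norm ((\<Sum>(t, K)\<in>p. measure lborel K *\<^sub>R ?w' t) - (w b - w a)) < e)"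
    proof (intro exI conjI allI impI; (elim conjE)?)
      show "gauge (\<lambda>t. ball t (d t))" using d(1) by (rule gauge_ball_dependent[rule_format])
    next
      fix p
      assume p: "p tagged_division_of {a..b}" and fine: "(\<lambda>t. ball t (d t)) fine p"
      define q where "q = {(t, K) \<in> p. t \<in> N}"
      have fin: "finite p" and qp: "q \<subseteq> p" using p by (auto simp: q_def)
      have cell: "\<exists>u v. K = {u..v} \<and> u \<le> v \<and> t \<in> {u..v} \<and> a \<le> u \<and> v \<le> b \<and> {u..v} \<subseteq> ball t (d t)"
        if "(t, K) \<in> p" for t K
      proof -
        obtain u v where K: "K = cbox u v" using p \<open>(t, K) \<in> p\<close> by blast
        moreover have "t \<in> K" "K \<subseteq> {a..b}" using p \<open>(t, K) \<in> p\<close> by blast+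
        moreover have "K \<subseteq> ball t (d t)" using fine that by (auto simp: fine_def)
        ultimately show ?thesis by auto
      qed
      have telescope: "(\<Sum>(t, K)\<in>p. w (Sup K) - w (Inf K)) = w b - w a"
        "(\<Sum>(t, K)\<in>p. Sup K - Inf K) = b - a"
        using additive_tagged_division_1[OF \<open>a \<le> b\<close> p, of w]
          additive_tagged_division_1[OF \<open>a \<le> b\<close> p, of "\<lambda>x. x"] by auto
      have regular: "norm (measure lborel K *\<^sub>R ?w' t - (w (Sup K) - w (Inf K))) \<le> \<eta> * (Sup K - Inf K)"
        if tK: "(t, K) \<in> p - q" for t K
      proof -
        obtain u v where K: "K = {u..v}" "u \<le> v" "t \<in> {u..v}" "a \<le> u" "v \<le> b" "{u..v} \<subseteq> ball t (d t)"
          using cell[of t K] tK by blast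
        have t: "t \<notin> N" using tK by (auto simp: q_def)
        have "norm (u - t) < d t" "norm (v - t) < d t"
          using K(2) subsetD[OF K(6), of u] subsetD[OF K(6), of v] by (auto simp: dist_real_def)
        then have "norm (w u - w t - (u - t) *\<^sub>R w' t) \<le> \<eta> * norm (u - t)"
            "norm (w v - w t - (v - t) *\<^sub>R w' t) \<le> \<eta> * norm (v - t)"
          using d(3)[of t u] d(3)[of t v] K(2-5) t by auto
        moreover have "(v - u) *\<^sub>R w' t - (w v - w u)
            = (w u - w t - (u - t) *\<^sub>R w' t) - (w v - w t - (v - t) *\<^sub>R w' t)"
          by (simp add: algebra_simps)
        ultimately have "norm ((v - u) *\<^sub>R w' t - (w v - w u)) \<le> \<eta> * norm (u - t) + \<eta> * norm (v - t)"
          by (simp only:) (rule norm_triangle_le_diff[OF add_mono])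
        also have "\<dots> = \<eta> * (v - u)" using K(3) by (simp add: algebra_simps)
        finally show ?thesis using K(1,2) t by simp
      qed
      have qtag: "q tagged_partial_division_of {a..b}"
        using tagged_partial_division_subset[OF _ qp] p by (auto simp: tagged_division_of_def)
      have qdiv: "(snd ` q) division_of \<Union>(snd ` q)"
        by (rule partial_division_of_tagged_division[OF qtag])
      have qsub: "\<Union>(snd ` q) \<subseteq> {a..b}" "\<Union>(snd ` q) \<subseteq> G"

        using cell qp d(2) unfolding q_def by (fastforce, fastforce)
      have "(\<Sum>K\<in>snd ` q. Sup K - Inf K) = (\<Sum>K\<in>snd ` q. measure lebesgue K)"
        using cell qp by (intro sum.cong) force+
      also have "\<dots> = measure lebesgue (\<Union>(snd ` q))"
        by (rule content_division[OF qdiv])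
      also have "\<dots> \<le> measure lebesgue G"
        using qsub(2) Gm(1) lmeasurable_division[OF qdiv] by (intro measure_mono_fmeasurable) auto
      also have "\<dots> < \<delta>" by (rule Gm)
      finally have small: "(\<Sum>K\<in>snd ` q. norm (w (Sup K) - w (Inf K))) < e / 2"
        using \<delta>[OF qdiv qsub(1)] by blast
      have ne: "K \<noteq> {}" if "(t, K) \<in> q" for t K
        using cell[of t K] that qp by auto
      let ?d = "\<lambda>K. if K = {} then 0 else norm (w (Sup K) - w (Inf K))"
      have "(\<Sum>(t, K)\<in>q. norm (w (Sup K) - w (Inf K))) = (\<Sum>(t, K)\<in>q. ?d K)"
        using ne by (intro sum.cong) auto
      also have "\<dots> = (\<Sum>K\<in>snd ` q. ?d K)"
      proof (rule sum.over_tagged_division_lemma[OF tagged_partial_division_of_Union_self[OF qtag]])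
        show "?d (cbox u v) = 0" if "box u v = {}" for u v :: real
          using that by (cases "u = v") auto
      qed
      also have "\<dots> = (\<Sum>K\<in>snd ` q. norm (w (Sup K) - w (Inf K)))"
        using ne by (intro sum.cong) auto
      finally have "(\<Sum>(t, K)\<in>q. norm (w (Sup K) - w (Inf K))) = (\<Sum>K\<in>snd ` q. norm (w (Sup K) - w (Inf K)))" .
      then have exceptional: "norm (\<Sum>(t, K)\<in>q. measure lborel K *\<^sub>R ?w' t - (w (Sup K) - w (Inf K))) < e / 2"
        using small by (intro le_less_trans[OF sum_norm_le[where g="\<lambda>(t,K). norm (w (Sup K) - w (Inf K))"]])
            (auto simp: q_def norm_minus_commute)
      have "norm (\<Sum>(t, K)\<in>p - q. measure lborel K *\<^sub>R ?w' t - (w (Sup K) - w (Inf K)))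
          \<le> (\<Sum>(t, K)\<in>p - q. \<eta> * (Sup K - Inf K))"
        by (rule sum_norm_le) (metis (no_types, lifting) case_prod_conv prod.exhaust_sel regular)
      also have "\<dots> \<le> (\<Sum>(t, K)\<in>p. \<eta> * (Sup K - Inf K))"
      proof (rule sum_mono2[OF fin])
        show "p - q \<subseteq> p" by blast
        show "0 \<le> (case x of (t, K) \<Rightarrow> \<eta> * (Sup K - Inf K))" if "x \<in> p - (p - q)" for x
          using cell[of "fst x" "snd x"] that \<eta>(1) by (auto simp: case_prod_unfold)
      qed
      also have "\<dots> = \<eta> * (b - a)"
        unfolding telescope(2)[symmetric] sum_distrib_left by (intro sum.cong) auto
      finally have "norm (\<Sum>(t, K)\<in>p - q. measure lborel K *\<^sub>R ?w' t - (w (Sup K) - w (Inf K))) < e / 2"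
        using \<eta>(2) by linarith
      then have "norm (\<Sum>(t, K)\<in>p. measure lborel K *\<^sub>R ?w' t - (w (Sup K) - w (Inf K))) < e"
        using exceptional unfolding sum.subset_diff[OF qp fin]
        by (intro le_less_trans[OF norm_triangle_ineq]) linarith
      moreover have "(\<Sum>(t, K)\<in>p. measure lborel K *\<^sub>R ?w' t - (w (Sup K) - w (Inf K)))
          = (\<Sum>(t, K)\<in>p. measure lborel K *\<^sub>R ?w' t) - (w b - w a)"
        unfolding telescope(1)[symmetric] by (simp add: sum_subtractf case_prod_unfold)
      ultimately show "norm ((\<Sum>(t, K)\<in>p. measure lborel K *\<^sub>R ?w' t) - (w b - w a)) < e"
        by simp
    qed
  qed
  then show ?thesis
    by (rule has_integral_spike[OF N, rotated]) auto
qed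

text \<open>Continuity of the integrand is asked for at the single time \<open>t\<close> only: the projected field is
  discontinuous along trajectories, but it is right-continuous at every time.\<close>

lemma indefinite_integral_has_vector_derivative:
  fixes \<phi> :: "real \<Rightarrow> 'a::banach"
  assumes int: "\<And>s. a \<le> s \<Longrightarrow> (\<phi> has_integral (w s - w a)) {a..s}"
    and "a \<le> t" and cont: "continuous (at t within {a..}) \<phi>"
  shows "(w has_vector_derivative \<phi> t) (at t within {a..})"
proof -
  have nhd: "at t within {a..} = at t within {a..t+1}"
    by (rule at_within_nhd[of _ "{..<t+1}"]) auto
  have "((\<lambda>s. integral {a..s} \<phi>) has_vector_derivative \<phi> t) (at t within {a..t+1} - {})"
  proof (rule integral_has_vector_derivative_continuous_at)
    show "\<phi> integrable_on {a..t+1}" using int[of "t+1"] \<open>a \<le> t\<close> by (auto simp: has_integral_iff)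
    show "continuous (at t within {a..t+1} - {}) \<phi>" using cont nhd by simp
  qed (use \<open>a \<le> t\<close> in auto)
  then have "((\<lambda>s. w a + integral {a..s} \<phi>) has_vector_derivative \<phi> t) (at t within {a..t+1})"
    by (auto intro!: derivative_eq_intros)
  then have "(w has_vector_derivative \<phi> t) (at t within {a..t+1})"
    by (rule has_vector_derivative_transform[rotated 2])
       (use int \<open>a \<le> t\<close> in \<open>auto simp: has_integral_iff\<close>)
  then show ?thesis using nhd by simp
qed

lemma indefinite_integral_continuous_on_atLeast:
  fixes \<phi> :: "real \<Rightarrow> 'a::banach"
  assumes int: "\<And>s. a \<le> s \<Longrightarrow> (\<phi> has_integral (w s - w a)) {a..s}"
  shows "continuous_on {a..} w"
proof -
  have "continuous (at t within {a..}) w" if "a \<le> t" for t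
  proof -
    have nhd: "at t within {a..} = at t within {a..t+1}"
      by (rule at_within_nhd[of _ "{..<t+1}"]) auto
    have "continuous_on {a..t+1} (\<lambda>s. integral {a..s} \<phi>)"
      using int[of "t+1"] that by (intro indefinite_integral_continuous_1) (auto simp: has_integral_iff)
    then have "continuous_on {a..t+1} (\<lambda>s. w a + integral {a..s} \<phi>)"
      by (intro continuous_intros)
    then have "continuous_on {a..t+1} w"
      by (rule continuous_on_eq) (use int in \<open>auto simp: has_integral_iff\<close>)
    then have "continuous (at t within {a..t+1}) w"
      using that unfolding continuous_on_eq_continuous_within by simp
    then show ?thesis using nhd by simp
  qed
  then show ?thesis by (simp add: continuous_on_eq_continuous_within)
qed

lemma AE_lebesgue_on_atLeast_iff:
  "(AE t in lebesgue_on {a::real..}. P t) \<longleftrightarrow> (\<exists>N. negligible N \<and> (\<forall>t\<ge>a. t \<notin> N \<longrightarrow> P t))"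
proof
  assume "AE t in lebesgue_on {a..}. P t"
  then obtain N where "N \<in> null_sets (lebesgue_on {a..})" "{t \<in> space (lebesgue_on {a..}). \<not> P t} \<subseteq> N"
    unfolding eventually_ae_filter by blast
  then show "\<exists>N. negligible N \<and> (\<forall>t\<ge>a. t \<notin> N \<longrightarrow> P t)"
    by (intro exI[of _ N]) (auto simp: null_sets_restrict_space negligible_iff_null_sets)
next
  assume "\<exists>N. negligible N \<and> (\<forall>t\<ge>a. t \<notin> N \<longrightarrow> P t)"
  then obtain N where "negligible N" "\<And>t. a \<le> t \<Longrightarrow> t \<notin> N \<Longrightarrow> P t" by blast
  then show "AE t in lebesgue_on {a..}. P t"
    by (intro AE_I'[of "N \<inter> {a..}"])
       (auto simp: null_sets_restrict_space intro: negligible_subset simp flip: negligible_iff_null_sets)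
qed

section \<open>Growth bounds and derivatives\<close>

text \<open>A mean value inequality which tolerates downward jumps. For \<open>\<epsilon> > 0\<close> consider the supremum \<open>T\<close> of the
  times at which \<open>v t - (M + \<epsilon>) t\<close> is at most its initial value. It is attained because jumps go down,
  and if it came before \<open>b\<close>, the right derivative at \<open>T\<close> would provide a later such time.\<close>

lemma growth_bound_right_derivative:
  fixes v :: "real \<Rightarrow> real"
  assumes "a \<le> b"
    and right: "\<And>t. \<lbrakk>a \<le> t; t < b\<rbrakk> \<Longrightarrow> \<exists>D\<le>M. (v has_real_derivative D) (at t within {t..})"
    and left: "\<And>t. \<lbrakk>a < t; t \<le> b\<rbrakk> \<Longrightarrow> \<exists>L. (v \<longlongrightarrow> L) (at_left t) \<and> v t \<le> L"
  shows "v b - v a \<le> M * (b - a)"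
proof -
  have "v b - v a \<le> (M + \<epsilon>) * (b - a)" if "\<epsilon> > 0" for \<epsilon>
  proof -
    define u where "u t = v t - (M + \<epsilon>) * t" for t
    define S where "S = {t \<in> {a..b}. u t \<le> u a}"
    define T where "T = Sup S"
    have S: "a \<in> S" "bdd_above S" "S \<subseteq> {a..b}" using \<open>a \<le> b\<close> by (auto simp: S_def)
    then have T: "a \<le> T" "T \<le> b" unfolding T_def
      using cSup_upper[of a S] cSup_least[of S b] by (auto simp: subset_iff)
    have "T \<in> S"
    proof (rule ccontr)
      assume "T \<notin> S"
      then have "a < T" "u T > u a" using S(1) T by (auto simp: S_def less_le)
      obtain L where L: "(v \<longlongrightarrow> L) (at_left T)" "v T \<le> L" using left \<open>a < T\<close> T(2) by blast
      have "(u \<longlongrightarrow> L - (M + \<epsilon>) * T) (at_left T)"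
        unfolding u_def by (intro tendsto_intros L)
      moreover have "u a < L - (M + \<epsilon>) * T" using L(2) \<open>u T > u a\<close> by (simp add: u_def)
      ultimately have "\<forall>\<^sub>F s in at_left T. u a < u s" by (rule order_tendstoD(1))
      then obtain d where d: "d < T" "\<And>s. \<lbrakk>d < s; s < T\<rbrakk> \<Longrightarrow> u a < u s"
        unfolding eventually_at_left_field by blast
      obtain s where "s \<in> S" "d < s"
        using less_cSupD[of S d] d(1) S(1) unfolding T_def by blast
      moreover have "s \<le> T" using \<open>s \<in> S\<close> S(2) unfolding T_def by (rule cSup_upper)
      ultimately show False using d(2)[of s] \<open>T \<notin> S\<close> by (cases "s = T") (auto simp: S_def)
    qed
    moreover have "\<not> T < b"
    proof
      assume "T < b"
      then obtain D where "D \<le> M" and D: "(v has_real_derivative D) (at T within {T..})"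
        using right T(1) by blast
      have "((\<lambda>s. (v s - v T) / (s - T)) \<longlongrightarrow> D) (at_right T)"
        using D unfolding has_field_derivative_iff
        by (rule tendsto_within_subset) auto
      moreover have "D < M + \<epsilon>" using \<open>D \<le> M\<close> that by simp
      ultimately have "\<forall>\<^sub>F s in at_right T. (v s - v T) / (s - T) < M + \<epsilon>" by (rule order_tendstoD(2))
      moreover have "\<forall>\<^sub>F s in at_right T. s < b" "\<forall>\<^sub>F s in at_right T. T < s"
        using \<open>T < b\<close> by (auto intro: eventually_at_right_less order_tendstoD)
      ultimately have "\<forall>\<^sub>F s in at_right T. (v s - v T) / (s - T) < M + \<epsilon> \<and> s < b \<and> T < s"
        by eventually_elim auto
      then obtain s where s: "(v s - v T) / (s - T) < M + \<epsilon>" "s < b" "T < s"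
        using eventually_happens'[OF trivial_limit_at_right_real[of T]] by blast
      then have "u s \<le> u T" by (simp add: u_def field_simps)
      then have "s \<in> S" using \<open>T \<in> S\<close> s T(1) by (auto simp: S_def)
      then have "s \<le> T" using S(2) unfolding T_def by (rule cSup_upper)
      then show False using s by simp
    qed
    ultimately have "b \<in> S" using T by auto
    then show ?thesis by (simp add: S_def u_def algebra_simps)
  qed
  then have "((\<lambda>\<epsilon>. (M + \<epsilon>) * (b - a)) \<longlongrightarrow> (M + 0) * (b - a)) (at_right 0)
      \<and> (\<forall>\<^sub>F \<epsilon> in at_right 0. v b - v a \<le> (M + \<epsilon>) * (b - a))"
    by (intro conjI tendsto_intros) (auto simp: eventually_at_filter)
  then show ?thesis
    using tendsto_lowerbound[OF _ _ trivial_limit_at_right_real] by fastforce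
qed

text \<open>The linearisation error lies between \<open>0\<close> and \<open>\<bar>y - w\<bar>\<^sup>2 / 2\<close>: the upper bound comes from competing
  with the projection of \<open>w\<close>, the lower one from the obtuse angle at that projection.\<close>

lemma has_derivative_half_infdist_squared:
  fixes S :: "'a::euclidean_space set"
  assumes S: "convex S" "closed S" "S \<noteq> {}"
  shows "((\<lambda>w. (infdist w S)\<^sup>2 / 2) has_derivative (\<lambda>h. (w - closest_point S w) \<bullet> h)) (at w)"
proof -
  have inf: "infdist w S = norm (w - closest_point S w)" for w
    using setdist_closest_point[OF S(2,3)] by (simp add: infdist_eq_setdist dist_norm)
  have bound: "\<bar>(infdist y S)\<^sup>2 / 2 - (infdist w S)\<^sup>2 / 2 - (w - closest_point S w) \<bullet> (y - w)\<bar>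
      \<le> (norm (y - w))\<^sup>2 / 2" for y
  proof -
    let ?p = "closest_point S w" and ?q = "closest_point S y"
    have "infdist y S \<le> norm (y - ?p)"
      using infdist_le closest_point_in_set[OF S(2,3)] by (metis dist_norm)
    then have "(infdist y S)\<^sup>2 \<le> (norm (y - ?p))\<^sup>2" by (simp add: infdist_nonneg power_mono)
    also have "\<dots> = (norm (w - ?p))\<^sup>2 + 2 * ((w - ?p) \<bullet> (y - w)) + (norm (y - w))\<^sup>2"
      unfolding power2_norm_eq_inner by (simp add: inner_diff inner_commute algebra_simps)
    finally have upper: "(infdist y S)\<^sup>2 \<le> (infdist w S)\<^sup>2 + 2 * ((w - ?p) \<bullet> (y - w)) + (norm (y - w))\<^sup>2"
      by (simp add: inf)
    have "(w - ?p) \<bullet> (?q - ?p) \<le> 0"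
      by (rule closest_point_dot[OF S(1,2) closest_point_in_set[OF S(2,3)]])
    then have "(norm (w - ?p))\<^sup>2 + 2 * ((w - ?p) \<bullet> (y - w)) \<le> (norm (w - ?p))\<^sup>2
        + 2 * ((w - ?p) \<bullet> ((y - ?q) - (w - ?p))) + (norm ((y - ?q) - (w - ?p)))\<^sup>2"
      using zero_le_power2[of "norm ((y - ?q) - (w - ?p))"]
      by (simp only: inner_diff_right) argo
    also have "\<dots> = (norm (y - ?q))\<^sup>2"
      unfolding power2_norm_eq_inner by (simp add: inner_diff inner_commute algebra_simps)
    finally have "(infdist w S)\<^sup>2 + 2 * ((w - ?p) \<bullet> (y - w)) \<le> (infdist y S)\<^sup>2" by (simp add: inf)
    moreover have "0 \<le> (norm (y - w))\<^sup>2" by simp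
    ultimately show ?thesis using upper by (simp add: abs_le_iff)
  qed
  show ?thesis
    unfolding has_derivative_at_alt
  proof (intro conjI allI impI)
    show "bounded_linear (\<lambda>h. (w - closest_point S w) \<bullet> h)" by (rule bounded_linear_inner_right)
  next
    fix e :: real assume "e > 0"
    have "norm ((infdist y S)\<^sup>2 / 2 - (infdist w S)\<^sup>2 / 2 - (w - closest_point S w) \<bullet> (y - w))
        \<le> e * norm (y - w)" if "norm (y - w) < 2 * e" for y
    proof -
      have "(norm (y - w))\<^sup>2 / 2 \<le> e * norm (y - w)"
        using mult_right_mono[of "norm (y - w)" "2 * e" "norm (y - w)"] that
        by (simp add: power2_eq_square)
      then show ?thesis using bound[of y] by simp
    qed
    then show "\<exists>d>0. \<forall>y. norm (y - w) < d \<longrightarrow>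
        norm ((infdist y S)\<^sup>2 / 2 - (infdist w S)\<^sup>2 / 2 - (w - closest_point S w) \<bullet> (y - w))
        \<le> e * norm (y - w)"
      using \<open>e > 0\<close> by (intro exI[of _ "2 * e"]) auto
  qed
qed

lemma has_vector_derivative_compose_has_derivative:
  assumes v: "(v has_vector_derivative v') (at t within S)" and h: "(h has_derivative h') (at (v t))"
  shows "((\<lambda>s. h (v s)) has_vector_derivative h' v') (at t within S)"
proof -
  interpret bounded_linear h' using h by (rule has_derivative_bounded_linear)
  show ?thesis
    using has_derivative_compose[OF v[unfolded has_vector_derivative_def] h]
    by (simp add: has_vector_derivative_def scaleR)
qed

lemma has_real_derivative_norm_squared:
  fixes v :: "real \<Rightarrow> 'a::real_inner"
  assumes "(v has_vector_derivative v') (at t within S)"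
  shows "((\<lambda>s. (norm (v s))\<^sup>2) has_real_derivative 2 * (v t \<bullet> v')) (at t within S)"
proof -
  have "((\<lambda>x. x \<bullet> x) has_derivative (\<lambda>h. v t \<bullet> h + h \<bullet> v t)) (at (v t))"
    by (auto intro!: derivative_eq_intros)
  from has_vector_derivative_compose_has_derivative[OF assms this] show ?thesis
    by (simp add: has_real_derivative_iff_has_vector_derivative power2_norm_eq_inner inner_commute)
qed

lemma has_vector_derivative_vecI:
  fixes v :: "real \<Rightarrow> real ^ 'k"
  assumes "\<And>j. ((\<lambda>s. v s $ j) has_vector_derivative v' $ j) (at t within S)"
  shows "(v has_vector_derivative v') (at t within S)"
  unfolding has_vector_derivative_def
  by (subst has_derivative_componentwise_within)
     (use assms in \<open>auto simp: Basis_vec_def inner_axis has_vector_derivative_def\<close>)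

section \<open>Gradients and Hessians of convex functions\<close>

lemma DERIV_along_line:
  fixes h :: "'a::real_inner \<Rightarrow> real"
  assumes "\<And>x. (h has_derivative (\<lambda>k. k \<bullet> D x)) (at x)"
  shows "((\<lambda>s. h (x + s *\<^sub>R v)) has_real_derivative v \<bullet> D (x + s *\<^sub>R v)) (at s)"
proof -
  have "((\<lambda>s. h (x + s *\<^sub>R v)) has_derivative (\<lambda>r. (r *\<^sub>R v) \<bullet> D (x + s *\<^sub>R v))) (at s)"
    by (rule has_derivative_compose[OF _ assms, of "\<lambda>s. x + s *\<^sub>R v"]) (auto intro!: derivative_eq_intros)
  then show ?thesis by (simp add: has_field_derivative_def mult.commute[of _ "v \<bullet> _"])
qed

lemma DERIV_directional_along_line:
  fixes D :: "'a::real_inner \<Rightarrow> 'a"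
  assumes D: "\<And>x. (D has_derivative H x) (at x)"
  shows "((\<lambda>s. v \<bullet> D (x + s *\<^sub>R v)) has_real_derivative v \<bullet> H (x + s *\<^sub>R v) v) (at s)"
proof -
  interpret bounded_linear "H (x + s *\<^sub>R v)" using D by (rule has_derivative_bounded_linear)
  have "((\<lambda>s. D (x + s *\<^sub>R v)) has_derivative (\<lambda>r. H (x + s *\<^sub>R v) (r *\<^sub>R v))) (at s)"
    by (rule has_derivative_compose[OF _ D, of "\<lambda>s. x + s *\<^sub>R v"]) (auto intro!: derivative_eq_intros)
  then have "((\<lambda>s. v \<bullet> D (x + s *\<^sub>R v)) has_derivative (\<lambda>r. v \<bullet> H (x + s *\<^sub>R v) (r *\<^sub>R v))) (at s)"
    by (rule has_derivative_inner_right)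
  then show ?thesis by (simp add: has_field_derivative_def scaleR mult.commute[of _ "v \<bullet> _"])
qed

text \<open>The mean value theorem for \<open>(y - x) \<bullet> D\<close> on the segment from \<open>x\<close> to \<open>y\<close>. The case \<open>c = 0\<close> is used for the
  convex constraints, the case \<open>c > 0\<close> for the strongly convex objective.\<close>

lemma gradient_strongly_monotone:
  fixes D :: "'a::real_inner \<Rightarrow> 'a"
  assumes D: "\<And>x. (D has_derivative H x) (at x)"
    and H: "\<And>x v. c * (v \<bullet> v) \<le> v \<bullet> H x v"
  shows "c * ((y - x) \<bullet> (y - x)) \<le> (y - x) \<bullet> (D y - D x)"
proof -
  let ?\<phi> = "\<lambda>s. (y - x) \<bullet> D (x + s *\<^sub>R (y - x))"
  obtain s where "0 < s" "s < (1::real)"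
    "?\<phi> 1 - ?\<phi> 0 = (1 - 0) * ((y - x) \<bullet> H (x + s *\<^sub>R (y - x)) (y - x))"
    using MVT2[OF zero_less_one, of ?\<phi> "\<lambda>s. (y - x) \<bullet> H (x + s *\<^sub>R (y - x)) (y - x)",
        OF DERIV_directional_along_line[OF D]] by metis
  then show ?thesis using H[of "y - x"] by (simp add: inner_diff_right)
qed

lemma tangent_below_if_gradient_monotone:
  fixes h :: "'a::real_inner \<Rightarrow> real"
  assumes h: "\<And>x. (h has_derivative (\<lambda>k. k \<bullet> D x)) (at x)"
    and D: "\<And>x y. 0 \<le> (y - x) \<bullet> (D y - D x)"
  shows "h x + (y - x) \<bullet> D x \<le> h y"
proof -
  let ?\<phi> = "\<lambda>s. h (x + s *\<^sub>R (y - x))"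
  obtain s where s: "0 < s" "s < (1::real)"
    "?\<phi> 1 - ?\<phi> 0 = (1 - 0) * ((y - x) \<bullet> D (x + s *\<^sub>R (y - x)))"
    using MVT2[OF zero_less_one DERIV_along_line[OF h], of x "y - x"] by blast
  have "0 \<le> s * ((y - x) \<bullet> (D (x + s *\<^sub>R (y - x)) - D x))"
    using D[where x=x and y="x + s *\<^sub>R (y - x)"] by simp
  then have "(y - x) \<bullet> D x \<le> (y - x) \<bullet> D (x + s *\<^sub>R (y - x))"
    using s(1) by (simp add: zero_le_mult_iff inner_diff_right)
  then show ?thesis using s(3) by simp
qed

text \<open>Comparing the tangents of \<open>h\<close> at two points of a line shows that the directional derivative is
  nondecreasing along it, so its derivative cannot be negative.\<close>

lemma convex_imp_Hessian_nonneg: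
  fixes h :: "'a::real_inner \<Rightarrow> real"
  assumes "convex_on UNIV h"
    and h: "\<And>x. (h has_derivative (\<lambda>k. k \<bullet> D x)) (at x)"
    and D: "\<And>x. (D has_derivative H x) (at x)"
  shows "0 \<le> v \<bullet> H x v"
proof (rule ccontr)
  assume "\<not> 0 \<le> v \<bullet> H x v"
  let ?\<phi> = "\<lambda>s. h (x + s *\<^sub>R v)" and ?\<psi> = "\<lambda>s. v \<bullet> D (x + s *\<^sub>R v)"
  have conv: "convex_on UNIV ?\<phi>"
  proof (rule convex_onI)
    fix t r s :: real assume "0 < t" "t < 1"
    have "x + ((1 - t) * r + t * s) *\<^sub>R v = (1 - t) *\<^sub>R (x + r *\<^sub>R v) + t *\<^sub>R (x + s *\<^sub>R v)"
      by (simp add: algebra_simps)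
    then show "?\<phi> ((1 - t) *\<^sub>R r + t *\<^sub>R s) \<le> (1 - t) * ?\<phi> r + t * ?\<phi> s"
      using convex_onD[OF assms(1), of t "x + r *\<^sub>R v" "x + s *\<^sub>R v"] \<open>0 < t\<close> \<open>t < 1\<close> by simp
  qed simp
  have tangent: "?\<phi> s - ?\<phi> r \<ge> ?\<psi> r * (s - r)" for r s
    using convex_on_imp_above_tangent[OF conv connected_UNIV, of r s] DERIV_along_line[OF h] by simp
  have "v \<bullet> H (x + 0 *\<^sub>R v) v < 0" using \<open>\<not> 0 \<le> v \<bullet> H x v\<close> by simp
  then obtain d where "d > 0" "\<And>s. \<lbrakk>0 < s; s < d\<rbrakk> \<Longrightarrow> ?\<psi> (0 + s) < ?\<psi> 0"
    using DERIV_neg_dec_right[OF DERIV_directional_along_line[where H=H, OF D]] by blast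
  then have "?\<psi> (d / 2) < ?\<psi> 0" by simp
  moreover have "(?\<psi> (d/2) - ?\<psi> 0) * (d / 2) \<ge> 0"
    using tangent[of 0 "d/2"] tangent[of "d/2" 0] by (simp add: algebra_simps)
  ultimately show False using \<open>d > 0\<close> by (simp add: zero_le_mult_iff)
qed

text \<open>Riesz representation of the derivative of a component of \<open>h\<close>; the component is selected by an
  inner product with \<open>e\<close>, so that real and vector-valued functions are treated alike.\<close>

lemma twice_continuously_differentiable_gradient:
  fixes h :: "'a::euclidean_space \<Rightarrow> 'b::real_inner"
  assumes "twice_continuously_differentiable h"
  obtains D H where "\<And>x. ((\<lambda>x. h x \<bullet> e) has_derivative (\<lambda>k. k \<bullet> D x)) (at x)"
    "\<And>x. (D has_derivative H x) (at x)"
proof -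
  obtain h' :: "'a \<Rightarrow> 'a \<Rightarrow>\<^sub>L 'b" and h'' :: "'a \<Rightarrow> 'a \<Rightarrow>\<^sub>L ('a \<Rightarrow>\<^sub>L 'b)"
    where h': "\<And>x. (h has_derivative h' x) (at x)" and h'': "\<And>x. (h' has_derivative h'' x) (at x)"
    using assms unfolding twice_continuously_differentiable_def by blast
  define D where "D x = (\<Sum>i\<in>Basis. (h' x i \<bullet> e) *\<^sub>R i)" for x
  define H where "H x v = (\<Sum>i\<in>Basis. (h'' x v i \<bullet> e) *\<^sub>R i)" for x v
  have D: "k \<bullet> D x = h' x k \<bullet> e" for x k
  proof -
    have "h' x k = (\<Sum>i\<in>Basis. (k \<bullet> i) *\<^sub>R h' x i)"
      using arg_cong[OF euclidean_representation[of k], of "h' x", symmetric]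
      by (simp only: blinfun.sum_right blinfun.scaleR_right)
    then have "h' x k \<bullet> e = (\<Sum>i\<in>Basis. (k \<bullet> i) * (h' x i \<bullet> e))"
      by (simp only: inner_sum_left inner_scaleR_left)
    also have "\<dots> = k \<bullet> D x"
      unfolding D_def inner_sum_right inner_scaleR_right by (rule sum.cong) simp_all
    finally show ?thesis by simp
  qed
  show thesis
  proof (rule that)
    show "((\<lambda>x. h x \<bullet> e) has_derivative (\<lambda>k. k \<bullet> D x)) (at x)" for x
      unfolding D by (rule has_derivative_inner_left[OF h'])
    have "((\<lambda>x. h' x i) has_derivative (\<lambda>v. h'' x v i)) (at x)" for x i
      by (rule bounded_linear.has_derivative[OF blinfun.bounded_linear_left h''])
    then show "(D has_derivative H x) (at x)" for x
      unfolding D_def[abs_def] H_def[abs_def]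
      by (intro has_derivative_sum has_derivative_scaleR_left has_derivative_inner_left)
  qed
qed

lemma gradient_eqI:
  assumes "(h has_derivative (\<lambda>k. k \<bullet> D)) (at x)"
  shows "gradient h x = D"
  unfolding gradient_def
proof (rule the_equality)
  show "GDERIV h x :> D" using assms by (simp add: gderiv_def)
  fix D' assume "GDERIV h x :> D'"
  then have "(\<lambda>k. k \<bullet> D') = (\<lambda>k. k \<bullet> D)"
    using assms by (metis gderiv_def has_derivative_unique)
  then have "(D' - D) \<bullet> (D' - D) = 0" unfolding inner_diff_right by (metis right_minus_eq)
  then show "D' = D" by simp
qed

lemma strongly_convex_Hessian_ge:
  fixes h :: "real ^ 'n \<Rightarrow> real"
  assumes "strongly_convex h"
    and h: "\<And>x. (h has_derivative (\<lambda>k. k \<bullet> D x)) (at x)"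
    and D: "\<And>x. (D has_derivative H x) (at x)"
  obtains c where "c > 0" "\<And>x v. c * (v \<bullet> v) \<le> v \<bullet> H x v"
proof -
  obtain c where "c > 0" and c: "\<And>x. loewner_le (mat c) (hessian h x)"
    using assms(1) unfolding strongly_convex_def by blast
  have "hessian h x *v v = H x v" for x v
  proof -
    have "gradient h = D" using gradient_eqI[OF h] by blast
    moreover have "frechet_derivative D (at x) = H x" using frechet_derivative_at[OF D] by simp
    moreover have "linear (H x)" using D has_derivative_linear by blast
    ultimately show ?thesis by (simp add: hessian_def matrix_works)
  qed
  moreover have "mat c *v v = c *\<^sub>R v" for v :: "real ^ 'n"
  proof -
    have "(\<Sum>j\<in>UNIV. (if i = j then c else 0) * v $ j) = (\<Sum>j\<in>UNIV. if j = i then c * v $ j else 0)" for i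
      by (rule sum.cong) auto
    then show ?thesis by (simp add: vec_eq_iff matrix_vector_mult_def mat_def)
  qed
  ultimately have "c * (v \<bullet> v) \<le> v \<bullet> H x v" for x v
    using c[of x] unfolding loewner_le_def by (metis inner_scaleR_right)
  then show thesis using that \<open>c > 0\<close> by blast
qed

section \<open>One coordinate of the projected dynamics\<close>

lemma at_within_atLeastLessThan_eq_at_left: "at t within {a..<t} = at_left t" if "a < t" for a t :: real
  by (rule at_within_nhd[of _ "{a<..}"]) (use that in auto)

lemma at_left_le_at_within_atLeast: "at_left t \<le> at t within {a..}" if "a < t" for a t :: real
  unfolding at_within_atLeastLessThan_eq_at_left[OF that, symmetric] by (rule at_le) auto

lemma eventually_at_within_atLeast:
  assumes "eventually P (at_right t)" "a < t \<Longrightarrow> eventually P (at_left t)"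
  shows "eventually P (at (t::real) within {a..})"
proof (cases "a < t")
  case True
  then have "eventually P (at t)" using assms by (simp add: eventually_at_split)
  then show ?thesis by (rule filter_leD[OF at_le[OF subset_UNIV]])
next
  case False
  then have "{a..} - {t} \<subseteq> {t<..}" by auto
  then show ?thesis using assms(1) unfolding eventually_at_filter by (auto elim!: eventually_mono)
qed

text \<open>The contribution of one coordinate to the sum in \<^const>\<open>V2\<close>, with value \<open>0\<close> on the excluded index
  set, so that the sum can run over all indices.\<close>

definition active_square :: "real \<Rightarrow> real \<Rightarrow> real" where
  "active_square \<gamma> y = (if y = 0 \<and> \<gamma> < 0 then 0 else \<gamma>\<^sup>2)"

text \<open>One coordinate of the multiplier equation, in integral form and on a half-line with arbitrary
  starting time \<open>a\<close>. Taking \<open>a\<close> to be the current time turns statements on \<open>at a within {a..}\<close> into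
  statements on right derivatives.\<close>

locale projected_coordinate =
  fixes a :: real and \<gamma> u :: "real \<Rightarrow> real"
  assumes \<gamma>_cont: "continuous_on {a..} \<gamma>"
    and nonneg: "\<And>t. a \<le> t \<Longrightarrow> 0 \<le> u t"
    and integral_eq: "\<And>s t. \<lbrakk>a \<le> s; s \<le> t\<rbrakk>
      \<Longrightarrow> ((\<lambda>r. proj_plus (\<gamma> r) (u r)) has_integral (u t - u s)) {s..t}"
begin

lemma u_continuous: "continuous_on {a..} u"
  by (rule indefinite_integral_continuous_on_atLeast[OF integral_eq]) auto

lemma u_tendsto: "a \<le> t \<Longrightarrow> (u \<longlongrightarrow> u t) (at t within {a..})"
  and \<gamma>_tendsto: "a \<le> t \<Longrightarrow> (\<gamma> \<longlongrightarrow> \<gamma> t) (at t within {a..})"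
  using u_continuous \<gamma>_cont by (auto simp: continuous_on_def)

lemma antimono_where_slope_negative:
  assumes "a \<le> s" "s \<le> t" "\<And>r. r \<in> {s..t} \<Longrightarrow> \<gamma> r < 0"
  shows "u t \<le> u s"
proof -
  have "u t - u s \<le> 0"
    by (rule has_integral_le[OF integral_eq[OF assms(1,2)] has_integral_0])
       (use assms(3) in \<open>force simp: proj_plus_def\<close>)
  then show ?thesis by simp
qed

lemma stays_zero:
  assumes "a \<le> s" "s \<le> t" "\<And>r. r \<in> {s..t} \<Longrightarrow> \<gamma> r < 0" "u s = 0"
  shows "u t = 0"
  using antimono_where_slope_negative[OF assms(1-3)] nonneg[of t] assms(1,2,4) by simp

lemma eventually_slope_below:
  assumes "a \<le> t" "\<gamma> t < m"
  obtains d where "d > 0" "\<And>r. \<lbrakk>a \<le> r; \<bar>r - t\<bar> < d\<rbrakk> \<Longrightarrow> \<gamma> r < m"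
proof -
  have "\<forall>\<^sub>F r in at t within {a..}. \<gamma> r < m" using \<gamma>_tendsto[OF assms(1)] assms(2) by (rule order_tendstoD)
  then obtain d where "d > 0" "\<And>r. \<lbrakk>r \<in> {a..}; r \<noteq> t; dist r t < d\<rbrakk> \<Longrightarrow> \<gamma> r < m"
    unfolding eventually_at by blast
  then have "\<gamma> r < m" if "a \<le> r" "\<bar>r - t\<bar> < d" for r
    using that assms(2) by (cases "r = t") (auto simp: dist_real_def)
  then show thesis using that \<open>d > 0\<close> by blast
qed

lemma eventually_right_zero:
  assumes "a \<le> t" "u t = 0" "\<gamma> t < 0"
  shows "\<forall>\<^sub>F s in at_right t. u s = 0 \<and> \<gamma> s < 0"
proof -
  obtain d where d: "d > 0" "\<And>r. \<lbrakk>a \<le> r; \<bar>r - t\<bar> < d\<rbrakk> \<Longrightarrow> \<gamma> r < 0"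
    using eventually_slope_below[OF assms(1,3)] by blast
  have "u s = 0 \<and> \<gamma> s < 0" if "t < s" "s < t + d" for s
    using stays_zero[of t s] d(2) assms that by auto
  then show ?thesis unfolding eventually_at_right_field using \<open>d > 0\<close>
    by (intro exI[of _ "t + d"]) auto
qed

text \<open>Near \<open>t\<close> the slope is negative, so \<open>u\<close> is nonincreasing there and cannot leave \<open>0\<close> once it has
  reached it.\<close>

lemma eventually_left_zero_or_positive:
  assumes "a < t" "u t = 0" "\<gamma> t < 0"
  shows "(\<forall>\<^sub>F s in at_left t. u s = 0 \<and> \<gamma> s < 0) \<or> (\<forall>\<^sub>F s in at_left t. u s > 0)"
proof -
  obtain d where d: "d > 0" "\<And>r. \<lbrakk>a \<le> r; \<bar>r - t\<bar> < d\<rbrakk> \<Longrightarrow> \<gamma> r < 0"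
    using eventually_slope_below[of t 0] assms by auto
  define l where "l = max a (t - d)"
  have l: "l < t" "a \<le> l" "t - d \<le> l" using assms \<open>d > 0\<close> by (auto simp: l_def)
  show ?thesis
  proof (cases "\<exists>r. l < r \<and> r < t \<and> u r = 0")
    case True
    then obtain r where r: "l < r" "r < t" "u r = 0" by blast
    have "u s = 0 \<and> \<gamma> s < 0" if "r < s" "s < t" for s
      using stays_zero[of r s] d(2) l r that by auto
    then show ?thesis unfolding eventually_at_left_field using r by blast
  next
    case False
    then have "u s > 0" if "l < s" "s < t" for s
      using nonneg[of s] that l by force
    then show ?thesis unfolding eventually_at_left_field using l by blast
  qed
qed

text \<open>The integrand is right-continuous at \<open>a\<close>. The delicate case is \<open>u a = 0\<close>, \<open>\<gamma> a < 0\<close>, in which \<open>u\<close>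
  stays at \<open>0\<close> and the projected slope is \<open>0\<close> to the right of \<open>a\<close>.\<close>

lemma right_derivative:
  "(u has_vector_derivative proj_plus (\<gamma> a) (u a)) (at a within {a..})"
proof (rule indefinite_integral_has_vector_derivative)
  have "((\<lambda>r. proj_plus (\<gamma> r) (u r)) \<longlongrightarrow> proj_plus (\<gamma> a) (u a)) (at a within {a..})"
  proof -
    consider "u a > 0" | "u a = 0" "\<gamma> a \<ge> 0" | "u a = 0" "\<gamma> a < 0"
      using nonneg[of a] by fastforce
    then show ?thesis
    proof cases
      case 1
      have "\<forall>\<^sub>F r in at a within {a..}. \<gamma> r = proj_plus (\<gamma> r) (u r)"
        using order_tendstoD(1)[OF u_tendsto[OF order_refl] 1] by eventually_elim (simp add: proj_plus_def)
      then show ?thesis using 1 \<gamma>_tendsto[of a]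
        by (auto simp: proj_plus_def intro: Lim_transform_eventually)
    next
      case 2
      show ?thesis
      proof (cases "\<gamma> a = 0")
        case True
        have "((\<lambda>r. \<bar>\<gamma> r\<bar>) \<longlongrightarrow> 0) (at a within {a..})"
          using tendsto_rabs[OF \<gamma>_tendsto[of a]] True by simp
        then show ?thesis using True 2
          by (auto simp: proj_plus_def intro!: Lim_null_comparison[where g="\<lambda>r. \<bar>\<gamma> r\<bar>"] eventuallyI)
      next
        case False
        then have "\<gamma> a > 0" using 2 by simp
        have "\<forall>\<^sub>F r in at a within {a..}. \<gamma> r = proj_plus (\<gamma> r) (u r)"
          using order_tendstoD(1)[OF \<gamma>_tendsto[OF order_refl] \<open>\<gamma> a > 0\<close>] by eventually_elim (simp add: proj_plus_def)
        then show ?thesis using 2 \<gamma>_tendsto[of a]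
          by (auto simp: proj_plus_def intro: Lim_transform_eventually)
      qed
    next
      case 3
      have "\<forall>\<^sub>F r in at a within {a..}. 0 = proj_plus (\<gamma> r) (u r)"
        using eventually_at_within_atLeast[OF eventually_right_zero[OF order_refl 3]]
        by (rule eventually_mono) (auto simp: proj_plus_def)
      then show ?thesis using 3 by (auto simp: proj_plus_def intro: Lim_transform_eventually[OF tendsto_const])
    qed
  qed
  then show "continuous (at a within {a..}) (\<lambda>r. proj_plus (\<gamma> r) (u r))"
    by (simp add: continuous_within)
qed (use integral_eq in auto)

lemma active_square_eventually:
  assumes "a \<le> t" "u t > 0 \<or> \<gamma> t > 0"
  shows "\<forall>\<^sub>F s in at t within {a..}. active_square (\<gamma> s) (u s) = (\<gamma> s)\<^sup>2"
proof -
  from assms(2) have "\<forall>\<^sub>F s in at t within {a..}. u s > 0 \<or> \<gamma> s > 0"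
  proof
    assume "u t > 0"
    from order_tendstoD(1)[OF u_tendsto[OF assms(1)] this] show ?thesis by eventually_elim simp
  next
    assume "\<gamma> t > 0"
    from order_tendstoD(1)[OF \<gamma>_tendsto[OF assms(1)] this] show ?thesis by eventually_elim simp
  qed
  then show ?thesis by eventually_elim (auto simp: active_square_def)
qed

text \<open>If \<open>u t = 0\<close> and \<open>\<gamma> t < 0\<close>, differentiability of \<open>u\<close> with derivative \<open>0\<close> excludes that \<open>u\<close> was positive just
  before \<open>t\<close>, since it would have arrived at \<open>0\<close> with slope \<open>\<gamma> t\<close>. So the square vanishes near \<open>t\<close>. In
  the boundary case \<open>\<gamma> t = 0\<close> it is squeezed between \<open>0\<close> and \<open>\<gamma>\<^sup>2\<close>.\<close>

lemma active_square_has_derivative: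
  assumes "a \<le> t"
    and \<gamma>': "(\<gamma> has_real_derivative \<gamma>') (at t within {a..})"
    and u': "(u has_vector_derivative proj_plus (\<gamma> t) (u t)) (at t within {a..})"
  shows "((\<lambda>s. active_square (\<gamma> s) (u s)) has_real_derivative
    (if u t = 0 \<and> \<gamma> t < 0 then 0 else 2 * \<gamma> t * \<gamma>')) (at t within {a..})"
proof -
  let ?h = "\<lambda>s. active_square (\<gamma> s) (u s)"
  have sq: "((\<lambda>s. (\<gamma> s)\<^sup>2) has_real_derivative 2 * \<gamma> t * \<gamma>') (at t within {a..})"
    using \<gamma>' by (auto intro!: derivative_eq_intros)
  consider "u t > 0 \<or> \<gamma> t > 0" | "u t = 0" "\<gamma> t = 0" | "u t = 0" "\<gamma> t < 0"
    using nonneg[OF assms(1)] by fastforce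
  then show ?thesis
  proof cases
    case 1
    then have "?h t = (\<gamma> t)\<^sup>2" by (auto simp: active_square_def)
    then have "\<forall>\<^sub>F s in at t within {a..}. ((\<gamma> s)\<^sup>2 - (\<gamma> t)\<^sup>2) / (s - t) = (?h s - ?h t) / (s - t)"
      using active_square_eventually[OF assms(1) 1] by (auto elim!: eventually_mono)
    then show ?thesis using 1 sq unfolding has_field_derivative_iff
      by (auto intro: Lim_transform_eventually)
  next
    case 2
    have "((\<lambda>s. \<bar>((\<gamma> s)\<^sup>2 - (\<gamma> t)\<^sup>2) / (s - t)\<bar>) \<longlongrightarrow> 0) (at t within {a..})"
      using sq 2 tendsto_rabs[of _ 0] unfolding has_field_derivative_iff by force
    then have "((\<lambda>s. (?h s - ?h t) / (s - t)) \<longlongrightarrow> 0) (at t within {a..})"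
      by (rule Lim_null_comparison[rotated])
         (use 2 in \<open>auto simp: active_square_def intro!: always_eventually divide_right_mono\<close>)
    then show ?thesis using 2 unfolding has_field_derivative_iff by simp
  next
    case 3
    have "\<forall>\<^sub>F s in at t within {a..}. u s = 0 \<and> \<gamma> s < 0"
    proof (rule eventually_at_within_atLeast[OF eventually_right_zero[OF assms(1) 3]])
      assume "a < t"
      have "\<not> (\<forall>\<^sub>F s in at_left t. u s > 0)"
      proof
        assume "\<forall>\<^sub>F s in at_left t. u s > 0"
        then obtain l where l: "l < t" "\<And>s. \<lbrakk>l < s; s < t\<rbrakk> \<Longrightarrow> u s > 0"
          unfolding eventually_at_left_field by blast
        obtain d where d: "d > 0" "\<And>r. \<lbrakk>a \<le> r; \<bar>r - t\<bar> < d\<rbrakk> \<Longrightarrow> \<gamma> r < \<gamma> t / 2"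
          using eventually_slope_below[OF assms(1), of "\<gamma> t / 2"] 3 by auto
        \<comment> \<open>on \<open>{m<..<t}\<close> both \<open>u > 0\<close> and \<open>\<gamma> < \<gamma> t / 2\<close> hold, so \<open>u\<close> falls with slope below \<open>\<gamma> t / 2\<close>\<close>
        define m where "m = Max {l, t - d, a}"
        have m: "m < t" "l \<le> m" "t - d \<le> m" "a \<le> m" using l(1) d(1) \<open>a < t\<close> by (auto simp: m_def)
        have slope: "(u s - u t) / (s - t) \<le> \<gamma> t / 2" if s: "m < s" "s < t" for s
        proof -
          have "((\<lambda>r. \<gamma> t / 2) has_integral (t - s) *\<^sub>R (\<gamma> t / 2)) {s..t}"
            using has_integral_const_real[of "\<gamma> t / 2" s t] s by simp
          moreover have "proj_plus (\<gamma> r) (u r) \<le> \<gamma> t / 2" if "r \<in> {s..t} - {t}" for r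
            using that s m l(2)[of r] d(2)[of r] by (auto simp: proj_plus_def)
          then have "(if r = t then \<gamma> t / 2 else proj_plus (\<gamma> r) (u r)) \<le> \<gamma> t / 2" if "r \<in> {s..t}" for r
            using that by auto
          moreover have "((\<lambda>r. if r = t then \<gamma> t / 2 else proj_plus (\<gamma> r) (u r)) has_integral (u t - u s)) {s..t}"
            by (rule has_integral_spike[OF negligible_sing[of t] _ integral_eq]) (use s m in auto)
          ultimately have "u t - u s \<le> (t - s) *\<^sub>R (\<gamma> t / 2)" by (meson has_integral_le)
          then show ?thesis using s by (simp add: field_simps)
        qed
        have "((\<lambda>s. (u s - u t) / (s - t)) \<longlongrightarrow> 0) (at t within {a..})"
          using u' 3 unfolding has_real_derivative_iff_has_vector_derivative[symmetric] has_field_derivative_iff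
          by (simp add: proj_plus_def)
        then have "((\<lambda>s. (u s - u t) / (s - t)) \<longlongrightarrow> 0) (at t within {m<..<t})"
          by (rule tendsto_within_subset) (use m in auto)
        then have "((\<lambda>s. (u s - u t) / (s - t)) \<longlongrightarrow> 0) (at_left t)"
          by (subst at_within_nhd[of t "{m<..}" "{..<t}" "{m<..<t}"]) (use m in auto)
        moreover have "\<forall>\<^sub>F s in at_left t. (u s - u t) / (s - t) \<le> \<gamma> t / 2"
          unfolding eventually_at_left_field using m slope by blast
        ultimately have "0 \<le> \<gamma> t / 2" by (rule tendsto_upperbound) simp
        then show False using 3 by simp
      qed
      then show "\<forall>\<^sub>F s in at_left t. u s = 0 \<and> \<gamma> s < 0"
        using eventually_left_zero_or_positive[OF \<open>a < t\<close> 3] by blast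
    qed
    then have "\<forall>\<^sub>F s in at t within {a..}. 0 = (?h s - ?h t) / (s - t)"
      by eventually_elim (use 3 in \<open>simp add: active_square_def\<close>)
    then show ?thesis using 3 unfolding has_field_derivative_iff
      by (auto intro: Lim_transform_eventually[OF tendsto_const])
  qed
qed

text \<open>A jump is possible only when \<open>u\<close> hits \<open>0\<close> with \<open>\<gamma> t < 0\<close>; the value then drops from \<open>(\<gamma> t)\<^sup>2\<close> to \<open>0\<close>.\<close>

lemma active_square_left_limit:
  assumes "a < t"
  shows "\<exists>L. ((\<lambda>s. active_square (\<gamma> s) (u s)) \<longlongrightarrow> L) (at_left t) \<and> active_square (\<gamma> t) (u t) \<le> L"
proof -
  have le: "at_left t \<le> at t within {a..}" by (rule at_left_le_at_within_atLeast[OF assms])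
  have \<gamma>2: "((\<lambda>s. (\<gamma> s)\<^sup>2) \<longlongrightarrow> (\<gamma> t)\<^sup>2) (at_left t)"
    using tendsto_mono[OF le \<gamma>_tendsto] assms by (intro tendsto_intros) auto
  consider "u t > 0 \<or> \<gamma> t > 0" | "u t = 0" "\<gamma> t = 0" | "u t = 0" "\<gamma> t < 0"
    using nonneg[of t] assms by fastforce
  then show ?thesis
  proof cases
    case 1
    then have "\<forall>\<^sub>F s in at_left t. (\<gamma> s)\<^sup>2 = active_square (\<gamma> s) (u s)"
      using filter_leD[OF le active_square_eventually[of t]] assms by (auto elim: eventually_mono)
    then show ?thesis using Lim_transform_eventually[OF \<gamma>2] 1
      by (intro exI[of _ "(\<gamma> t)\<^sup>2"]) (auto simp: active_square_def)
  next
    case 2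
    have "((\<lambda>s. active_square (\<gamma> s) (u s)) \<longlongrightarrow> 0) (at_left t)"
    proof (rule Lim_null_comparison)
      show "\<forall>\<^sub>F s in at_left t. norm (active_square (\<gamma> s) (u s)) \<le> (\<gamma> s)\<^sup>2"
        by (simp add: active_square_def)
      show "((\<lambda>s. (\<gamma> s)\<^sup>2) \<longlongrightarrow> 0) (at_left t)" using \<gamma>2 2(2) by simp
    qed
    then show ?thesis using 2 by (intro exI[of _ 0]) (auto simp: active_square_def)
  next
    case 3
    from eventually_left_zero_or_positive[OF assms 3] show ?thesis
    proof
      assume "\<forall>\<^sub>F s in at_left t. u s = 0 \<and> \<gamma> s < 0"
      then have "\<forall>\<^sub>F s in at_left t. 0 = active_square (\<gamma> s) (u s)"
        by eventually_elim (simp add: active_square_def)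
      from Lim_transform_eventually[OF tendsto_const this] show ?thesis
        using 3 by (intro exI[of _ 0]) (simp add: active_square_def[of "\<gamma> t"])
    next
      assume "\<forall>\<^sub>F s in at_left t. u s > 0"
      then have "\<forall>\<^sub>F s in at_left t. (\<gamma> s)\<^sup>2 = active_square (\<gamma> s) (u s)"
        by eventually_elim (simp add: active_square_def)
      from Lim_transform_eventually[OF \<gamma>2 this] show ?thesis
        using 3 by (intro exI[of _ "(\<gamma> t)\<^sup>2"]) (simp add: active_square_def[of "\<gamma> t"])
    qed
  qed
qed

end

section \<open>The saddle-point problem\<close>

lemma inner_matrix_vector_transpose: "(z::real^'m) \<bullet> (A *v x) = x \<bullet> (transpose A *v z)"
  for A :: "real^'n^'m"
  by (metis dot_lmul_matrix inner_commute transpose_matrix_vector)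

lemma inner_self_le_0_iff: "v \<bullet> v \<le> 0 \<longleftrightarrow> v = 0"
  by (metis inner_eq_zero_iff inner_ge_zero order_antisym order_refl)

lemma inner_vec_sum: "(y::real^'p) \<bullet> v = (\<Sum>j\<in>UNIV. y $ j * v $ j)"
  by (simp add: inner_vec_def)

text \<open>The gradients \<open>Df\<close>, \<open>Dg\<close> and Hessians \<open>Hf\<close>, \<open>Hg\<close> are parameters, tied to \<open>f\<close> and \<open>g\<close> by their
  derivative properties, and convexity enters through the quadratic forms of the Hessians. A
  reference saddle point is fixed, in terms of which the decay rate is expressed.\<close>

locale saddle_problem =
  fixes f :: "real ^ 'n \<Rightarrow> real"
    and g :: "real ^ 'n \<Rightarrow> real ^ 'p"
    and A :: "real ^ 'n ^ 'm"
    and b :: "real ^ 'm"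
    and F :: "(real ^ 'n) \<times> (real ^ 'p) \<times> (real ^ 'm) \<Rightarrow> real"
    and Df :: "real ^ 'n \<Rightarrow> real ^ 'n" and Hf :: "real ^ 'n \<Rightarrow> real ^ 'n \<Rightarrow> real ^ 'n"
    and Dg :: "'p \<Rightarrow> real ^ 'n \<Rightarrow> real ^ 'n" and Hg :: "'p \<Rightarrow> real ^ 'n \<Rightarrow> real ^ 'n \<Rightarrow> real ^ 'n"
    and c :: real and xs :: "real ^ 'n" and ys :: "real ^ 'p" and zs :: "real ^ 'm"
  assumes F_def: "F = lagrangian f g A b"
    and Df: "\<And>x. (f has_derivative (\<lambda>k. k \<bullet> Df x)) (at x)"
    and Hf: "\<And>x. (Df has_derivative Hf x) (at x)"
    and Dg: "\<And>j x. ((\<lambda>x. g x $ j) has_derivative (\<lambda>k. k \<bullet> Dg j x)) (at x)"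
    and Hg: "\<And>j x. (Dg j has_derivative Hg j x) (at x)"
    and c_pos: "c > 0"
    and Hf_ge: "\<And>x v. c * (v \<bullet> v) \<le> v \<bullet> Hf x v"
    and Hg_ge: "\<And>j x v. 0 \<le> v \<bullet> Hg j x v"
    and saddle: "(xs, ys, zs) \<in> Saddle F"
begin

lemma lagrangian_eq: "F (x, y, z) = f x + y \<bullet> g x + z \<bullet> (A *v x - b)"
  by (simp add: F_def lagrangian_def)

lemma lagrangian_has_derivative_x:
  "((\<lambda>x. F (x, y, z)) has_derivative
    (\<lambda>k. k \<bullet> (Df x + (\<Sum>j\<in>UNIV. y $ j *\<^sub>R Dg j x) + transpose A *v z))) (at x)"
proof -
  have "((\<lambda>x. f x + (\<Sum>j\<in>UNIV. y $ j * g x $ j) + z \<bullet> (A *v x - b)) has_derivative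
      (\<lambda>k. k \<bullet> Df x + (\<Sum>j\<in>UNIV. y $ j * (k \<bullet> Dg j x)) + z \<bullet> (A *v k))) (at x)"
    by (auto intro!: derivative_eq_intros Df Dg bounded_linear_imp_has_derivative[OF matrix_vector_mul_bounded_linear])
  then show ?thesis
    by (simp add: lagrangian_eq inner_vec_sum[of y] inner_matrix_vector_transpose[where A=A] inner_add_right inner_sum_right)
qed

lemma grad_x_eq: "grad_x F (x, y, z) = Df x + (\<Sum>j\<in>UNIV. y $ j *\<^sub>R Dg j x) + transpose A *v z"
  unfolding grad_x_def by (simp add: gradient_eqI[OF lagrangian_has_derivative_x])

lemma grad_y_eq: "grad_y F (x, y, z) = g x"
proof -
  have "((\<lambda>y. F (x, y, z)) has_derivative (\<lambda>k. k \<bullet> g x)) (at y)"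
    unfolding lagrangian_eq by (auto intro!: derivative_eq_intros)
  then show ?thesis unfolding grad_y_def by (simp add: gradient_eqI)
qed

lemma grad_z_eq: "grad_z F (x, y, z) = A *v x - b"
proof -
  have "((\<lambda>z. F (x, y, z)) has_derivative (\<lambda>k. k \<bullet> (A *v x - b))) (at z)"
    unfolding lagrangian_eq by (auto intro!: derivative_eq_intros)
  then show ?thesis unfolding grad_z_def by (simp add: gradient_eqI)
qed

lemma saddle_field_eq:
  "saddle_field F (x, y, z) = (- grad_x F (x, y, z), proj_plus_vec (g x) y, A *v x - b)"
  by (simp add: saddle_field_def grad_y_eq grad_z_eq)

definition lagrangian_Hessian :: "real ^ 'n \<Rightarrow> real ^ 'p \<Rightarrow> real ^ 'n \<Rightarrow> real ^ 'n" where
  "lagrangian_Hessian x y v = Hf x v + (\<Sum>j\<in>UNIV. y $ j *\<^sub>R Hg j x v)"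

lemma grad_x_has_derivative_x:
  "((\<lambda>x. grad_x F (x, y, z)) has_derivative lagrangian_Hessian x y) (at x)"
  unfolding grad_x_eq lagrangian_Hessian_def[abs_def]
  by (auto intro!: derivative_eq_intros Hf Hg)

lemma lagrangian_Hessian_ge:
  assumes "\<And>j. 0 \<le> y $ j"
  shows "c * (v \<bullet> v) \<le> v \<bullet> lagrangian_Hessian x y v"
  using Hf_ge[of v x] assms Hg_ge
  by (simp add: lagrangian_Hessian_def inner_add_right inner_sum_right add_increasing2 sum_nonneg)

lemma lagrangian_tangent_x:
  assumes "\<And>j. 0 \<le> y $ j"
  shows "F (x, y, z) + (x' - x) \<bullet> grad_x F (x, y, z) \<le> F (x', y, z)"
proof (rule tangent_below_if_gradient_monotone)
  show "((\<lambda>x. F (x, y, z)) has_derivative (\<lambda>k. k \<bullet> grad_x F (x, y, z))) (at x)" for x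
    unfolding grad_x_eq by (rule lagrangian_has_derivative_x)
  show "0 \<le> (x' - x) \<bullet> (grad_x F (x', y, z) - grad_x F (x, y, z))" for x x'
  proof -
    have "0 \<le> c * ((x' - x) \<bullet> (x' - x))" using c_pos by simp
    also have "\<dots> \<le> (x' - x) \<bullet> (grad_x F (x', y, z) - grad_x F (x, y, z))"
      by (rule gradient_strongly_monotone[OF grad_x_has_derivative_x lagrangian_Hessian_ge[OF assms]])
    finally show ?thesis .
  qed
qed

lemma constraint_tangent: "g x $ j + (x' - x) \<bullet> Dg j x \<le> g x' $ j"
  by (rule tangent_below_if_gradient_monotone[OF Dg])
     (use gradient_strongly_monotone[OF Hg, of 0] Hg_ge in simp)

text \<open>Necessity tests the saddle inequalities with single perturbations: raising \<open>y\<^sub>j\<close> by \<open>1\<close>, setting \<open>y\<^sub>j\<close>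
  to \<open>0\<close>, and moving \<open>z\<close> by the residual \<open>A x - b\<close>. Sufficiency is convexity of the Lagrangian in \<open>x\<close>.\<close>

lemma Saddle_iff_KKT:
  "(x, y, z) \<in> Saddle F \<longleftrightarrow> (\<forall>j. 0 \<le> y $ j) \<and> grad_x F (x, y, z) = 0 \<and> A *v x = b
     \<and> (\<forall>j. g x $ j \<le> 0) \<and> (\<forall>j. y $ j * g x $ j = 0)" (is "?S \<longleftrightarrow> ?KKT")
proof
  assume ?S
  then have y: "0 \<le> y $ j" for j by (simp add: Saddle_def state_space_def)
  have max: "F (x, y', z') \<le> F (x, y, z)" if "\<And>j. 0 \<le> y' $ j" for y' z'
    using \<open>?S\<close> that by (auto simp: Saddle_def state_space_def)
  have min: "F (x, y, z) \<le> F (x', y, z)" for x'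
    using \<open>?S\<close> y by (auto simp: Saddle_def state_space_def)
  have "(\<lambda>k. k \<bullet> grad_x F (x, y, z)) = (\<lambda>k. 0)"
    using has_derivative_local_min[OF lagrangian_has_derivative_x[of y z x]] min
    by (simp add: grad_x_eq)
  then have "grad_x F (x, y, z) = 0" by (metis inner_eq_zero_iff)
  moreover have "A *v x - b = 0"
    using max[of y "z + (A *v x - b)"] y
    by (simp add: lagrangian_eq inner_add_left inner_self_le_0_iff)
  moreover have g: "g x $ j \<le> 0" for j
  proof -
    have "0 \<le> (y + axis j 1) $ i" for i using y[of i] by (simp add: axis_def)
    from max[OF this, of z] show ?thesis by (simp add: lagrangian_eq inner_add_left inner_axis')
  qed
  moreover have "y $ j * g x $ j = 0" for j
  proof -
    have "0 \<le> (y - axis j (y $ j)) $ i" for i using y[of i] by (simp add: axis_def)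
    from max[OF this, of z] have "y $ j * g x $ j \<ge> 0"
      by (simp add: lagrangian_eq inner_diff_left inner_axis')
    then show ?thesis using mult_nonneg_nonpos[OF y g, of j j] by simp
  qed
  ultimately show ?KKT using y by simp
next
  assume K: ?KKT
  have "F (x, y', z') \<le> F (x, y, z)" if "\<And>j. 0 \<le> y' $ j" for y' z'
  proof -
    have "y' \<bullet> g x \<le> 0" using K that by (simp add: inner_vec_sum mult_nonneg_nonpos sum_nonpos)
    moreover have "y \<bullet> g x = 0" using K by (simp only: inner_vec_sum sum.neutral_const)
    ultimately show ?thesis using K by (simp add: lagrangian_eq)
  qed
  moreover have "F (x, y, z) \<le> F (x', y, z)" for x'
    using lagrangian_tangent_x[of y x z x'] K by simp
  ultimately show ?S using K by (auto simp: Saddle_def state_space_def)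
qed

lemma proj_plus_eq: "proj_plus a y = (if y = 0 \<and> a < 0 then 0 else a)" if "0 \<le> y"
  using that by (auto simp: proj_plus_def)

text \<open>The skew terms in \<open>z\<close> cancel, and projecting the slope of \<open>y\<^sub>j\<close> only helps because \<open>y\<^sub>j = 0 \<le> y'\<^sub>j\<close>
  whenever it is changed. The tangent inequalities for \<open>g\<^sub>j\<close> at both points and strong monotonicity
  of \<open>Df\<close> leave the right-hand side, which is nonpositive by feasibility of \<open>x'\<close>.\<close>

lemma saddle_field_dissipative:
  assumes q: "(x', y', z') \<in> Saddle F" and w: "(x, y, z) \<in> state_space"
  shows "((x, y, z) - (x', y', z')) \<bullet> saddle_field F (x, y, z)
    \<le> - c * ((x - x') \<bullet> (x - x')) + y \<bullet> g x'"
proof -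
  have y: "0 \<le> y $ j" for j using w by (simp add: state_space_def)
  have K: "0 \<le> y' $ j" "Df x' + (\<Sum>j\<in>UNIV. y' $ j *\<^sub>R Dg j x') + transpose A *v z' = 0"
    "A *v x' = b" "g x' $ j \<le> 0" "y' $ j * g x' $ j = 0" for j
    using q unfolding Saddle_iff_KKT grad_x_eq by auto
  have f: "c * ((x - x') \<bullet> (x - x')) \<le> (x - x') \<bullet> (Df x - Df x')"
    by (rule gradient_strongly_monotone[OF Hf Hf_ge])
  \<comment> \<open>the coordinate \<open>j\<close> of the \<open>y\<close>-equation together with the \<open>j\<close>-th term of the gradient in \<open>x\<close>\<close>
  have coord: "(y $ j - y' $ j) * proj_plus (g x $ j) (y $ j) - y $ j * ((x - x') \<bullet> Dg j x)
      + y' $ j * ((x - x') \<bullet> Dg j x') \<le> y $ j * g x' $ j" for j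
  proof -
    have "(y $ j - y' $ j) * proj_plus (g x $ j) (y $ j) \<le> (y $ j - y' $ j) * g x $ j"
      using y[of j] K(1)[of j] by (auto simp: proj_plus_eq mult_nonpos_nonpos mult_nonneg_nonpos)
    moreover have "y $ j * (g x $ j - g x' $ j) \<le> y $ j * ((x - x') \<bullet> Dg j x)"
      using constraint_tangent[of x j x'] by (intro mult_left_mono y) (simp add: inner_diff_left)
    moreover have "y' $ j * ((x - x') \<bullet> Dg j x') \<le> y' $ j * (g x $ j - g x' $ j)"
      using constraint_tangent[of x' j x] by (intro mult_left_mono K(1)) simp
    ultimately show ?thesis using K(5)[of j] by (simp add: algebra_simps)
  qed
  have coupling: "(z - z') \<bullet> (A *v (x - x')) = (x - x') \<bullet> (transpose A *v z) - (x - x') \<bullet> (transpose A *v z')"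
    unfolding inner_matrix_vector_transpose[where A=A] by (simp add: matrix_vector_mult_diff_distrib inner_diff_right)
  have "((x, y, z) - (x', y', z')) \<bullet> saddle_field F (x, y, z)
      = - ((x - x') \<bullet> (grad_x F (x, y, z) - grad_x F (x', y', z')))
        + (\<Sum>j\<in>UNIV. (y $ j - y' $ j) * proj_plus (g x $ j) (y $ j)) + (z - z') \<bullet> (A *v (x - x'))"
    using q unfolding Saddle_iff_KKT
    by (simp add: saddle_field_eq inner_vec_sum[of "y - y'"] proj_plus_vec_def matrix_vector_mult_diff_distrib)
  also have "\<dots> = - ((x - x') \<bullet> (Df x - Df x')) + (\<Sum>j\<in>UNIV. (y $ j - y' $ j) * proj_plus (g x $ j) (y $ j)
      - y $ j * ((x - x') \<bullet> Dg j x) + y' $ j * ((x - x') \<bullet> Dg j x'))"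
    unfolding coupling grad_x_eq
    by (simp add: inner_add_right inner_diff_right inner_sum_right sum.distrib sum_subtractf)
  also have "\<dots> \<le> - c * ((x - x') \<bullet> (x - x')) + (\<Sum>j\<in>UNIV. y $ j * g x' $ j)"
    using f by (intro add_mono sum_mono coord) simp
  finally show ?thesis by (simp add: inner_vec_sum[of y])
qed

text \<open>The upper bound for the derivative of \<^const>\<open>V2\<close> along the flow: the first term comes from the squared
  speed of the field, the others from the squared distance to the saddle points.\<close>

fun decay :: "(real ^ 'n) \<times> (real ^ 'p) \<times> (real ^ 'm) \<Rightarrow> real" where
  "decay (x, y, z) = - c * (norm (grad_x F (x, y, z)))\<^sup>2 - c * (norm (x - xs))\<^sup>2 + y \<bullet> g xs"

lemma saddle_KKT:
  "A *v xs = b" "g xs $ j \<le> 0"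
  using saddle unfolding Saddle_iff_KKT by auto

lemma inner_constraint_nonpos: "(x, y, z) \<in> state_space \<Longrightarrow> y \<bullet> g xs \<le> 0"
  using saddle_KKT by (simp add: inner_vec_sum state_space_def mult_nonneg_nonpos sum_nonpos)

lemma decay_nonpos:
  assumes "w \<in> state_space"
  shows "decay w \<le> 0"
proof (cases w)
  case (fields x y z)
  have "0 \<le> c * (norm (grad_x F (x, y, z)))\<^sup>2" "0 \<le> c * (norm (x - xs))\<^sup>2"
    using c_pos by auto
  then show ?thesis using inner_constraint_nonpos[of x y z] assms fields by simp
qed

lemma Saddle_subset_state_space: "Saddle F \<subseteq> state_space"
  by (auto simp: Saddle_def)

lemma saddle_field_zero: "w \<in> Saddle F \<Longrightarrow> saddle_field F w = 0"
proof (cases w)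
  case (fields x y z)
  assume "w \<in> Saddle F"
  then have "(x, y, z) \<in> Saddle F" using fields by simp
  note K = this[unfolded Saddle_iff_KKT]
  have "proj_plus (g x $ j) (y $ j) = 0" for j
    using K by (metis proj_plus_def mult_eq_0_iff less_irrefl max.absorb1)
  then have "proj_plus_vec (g x) y = 0" by (simp add: proj_plus_vec_def vec_eq_iff)
  then show ?thesis using K fields by (simp add: saddle_field_eq zero_prod_def)
qed

text \<open>The field vanishes at a saddle point, so the dissipation inequality forces the quadratic term
  to vanish there.\<close>

lemma Saddle_x_unique: "(x, y, z) \<in> Saddle F \<Longrightarrow> x = xs"
proof -
  assume w: "(x, y, z) \<in> Saddle F"
  then have st: "(x, y, z) \<in> state_space" using Saddle_subset_state_space by auto
  have "0 \<le> - c * ((x - xs) \<bullet> (x - xs)) + y \<bullet> g xs"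
    using saddle_field_dissipative[OF saddle st] saddle_field_zero[OF w] by simp
  then have "c * ((x - xs) \<bullet> (x - xs)) \<le> 0" using inner_constraint_nonpos[OF st] by simp
  then show "x = xs" using c_pos by (simp add: mult_le_0_iff inner_self_le_0_iff)
qed

lemma decay_eq_0_iff:
  assumes "w \<in> state_space"
  shows "decay w = 0 \<longleftrightarrow> w \<in> Saddle F"
proof (cases w)
  case (fields x y z)
  have st: "(x, y, z) \<in> state_space" using assms fields by simp
  then have y: "0 \<le> y $ j" for j by (simp add: state_space_def)
  have sum0: "y \<bullet> g xs = 0 \<longleftrightarrow> (\<forall>j. y $ j * g xs $ j = 0)"
    using sum_nonneg_eq_0_iff[of UNIV "\<lambda>j. - (y $ j * g xs $ j)"]
    by (simp add: inner_vec_sum sum_negf y saddle_KKT mult_nonneg_nonpos del: mult_eq_0_iff)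
  have "decay w = 0 \<longleftrightarrow> grad_x F (x, y, z) = 0 \<and> x = xs \<and> y \<bullet> g xs = 0"
  proof
    assume "decay w = 0"
    moreover have "0 \<le> c * (norm (grad_x F (x, y, z)))\<^sup>2" "0 \<le> c * (norm (x - xs))\<^sup>2"
      using c_pos by auto
    ultimately have "c * (norm (grad_x F (x, y, z)))\<^sup>2 = 0" "c * (norm (x - xs))\<^sup>2 = 0" "y \<bullet> g xs = 0"
      using inner_constraint_nonpos[OF st] unfolding fields decay.simps by linarith+
    then show "grad_x F (x, y, z) = 0 \<and> x = xs \<and> y \<bullet> g xs = 0" using c_pos by simp
  qed (use fields in auto)
  then show ?thesis
    using Saddle_x_unique[of x y z] y saddle_KKT fields sum0
    by (auto simp: Saddle_iff_KKT)
qed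

lemma continuous_gradients: "continuous_on UNIV Df" "continuous_on UNIV (Dg j)" "continuous_on UNIV g"
proof -
  show "continuous_on UNIV Df"
    by (rule continuous_at_imp_continuous_on) (blast intro: has_derivative_continuous[OF Hf])
  show "continuous_on UNIV (Dg j)"
    by (rule continuous_at_imp_continuous_on) (blast intro: has_derivative_continuous[OF Hg])
  have "continuous_on UNIV (\<lambda>x. g x $ j)" for j
    by (rule continuous_at_imp_continuous_on) (blast intro: has_derivative_continuous[OF Dg])
  then have "continuous_on UNIV (\<lambda>x. \<chi> j. g x $ j)" by (rule continuous_on_vec_lambda)
  then show "continuous_on UNIV g" by simp
qed

lemma grad_x_conv: "grad_x F w = Df (fst w) + (\<Sum>j\<in>UNIV. fst (snd w) $ j *\<^sub>R Dg j (fst w))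
    + transpose A *v snd (snd w)"
  by (cases w) (simp add: grad_x_eq)

lemma continuous_grad_x: "continuous_on UNIV (grad_x F)"
  unfolding grad_x_conv[abs_def]
  by (intro continuous_intros continuous_on_compose2[OF continuous_gradients(1)]
      continuous_on_compose2[OF continuous_gradients(2)]
      linear_continuous_on_compose[OF _ matrix_vector_mul_linear]) auto

lemma continuous_decay: "continuous_on UNIV decay"
proof -
  have "decay = (\<lambda>w. - c * (norm (grad_x F w))\<^sup>2 - c * (norm (fst w - xs))\<^sup>2 + fst (snd w) \<bullet> g xs)"
    by (auto simp: fun_eq_iff)
  then show ?thesis using continuous_grad_x by (auto intro!: continuous_intros)
qed

lemma closed_state_space: "closed (state_space :: ((real ^ 'n) \<times> (real ^ 'p) \<times> (real ^ 'm)) set)"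
proof -
  have eq: "state_space = (\<Inter>j. {w::(real ^ 'n) \<times> (real ^ 'p) \<times> (real ^ 'm). 0 \<le> fst (snd w) $ j})"
    by (auto simp: state_space_def)
  show ?thesis unfolding eq by (intro closed_INT ballI closed_Collect_le continuous_intros)
qed

lemma closed_Saddle: "closed (Saddle F)"
proof -
  have "Saddle F = state_space \<inter> (decay -` {0})"
    using decay_eq_0_iff Saddle_subset_state_space by auto
  then show ?thesis
    using closed_state_space continuous_closed_vimage[of "{0}" decay] continuous_decay
    by (auto simp: continuous_on_eq_continuous_at)
qed

text \<open>As \<open>x = x\<^sub>*\<close> at all saddle points, the KKT conditions are affine in the remaining variables
  \<open>(y, z)\<close>.\<close>

lemma convex_Saddle: "convex (Saddle F)"
proof (rule convexI)
  fix w v and r s :: real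
  assume wv: "w \<in> Saddle F" "v \<in> Saddle F" and rs: "0 \<le> r" "0 \<le> s" "r + s = 1"
  obtain x y z where w: "w = (x, y, z)" by (cases w)
  obtain x' y' z' where v: "v = (x', y', z')" by (cases v)
  have x: "x = xs" "x' = xs" using wv Saddle_x_unique unfolding w v by blast+
  have K: "\<forall>j. 0 \<le> y $ j" "\<forall>j. 0 \<le> y' $ j" "\<forall>j. y $ j * g xs $ j = 0" "\<forall>j. y' $ j * g xs $ j = 0"
    "grad_x F (xs, y, z) = 0" "grad_x F (xs, y', z') = 0"
    using wv unfolding w v x Saddle_iff_KKT by auto
  have "grad_x F (xs, r *\<^sub>R y + s *\<^sub>R y', r *\<^sub>R z + s *\<^sub>R z')
      = (r + s) *\<^sub>R Df xs + (\<Sum>j\<in>UNIV. (r *\<^sub>R y + s *\<^sub>R y') $ j *\<^sub>R Dg j xs) + transpose A *v (r *\<^sub>R z + s *\<^sub>R z')"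
    by (simp add: grad_x_eq rs(3))
  also have "\<dots> = r *\<^sub>R grad_x F (xs, y, z) + s *\<^sub>R grad_x F (xs, y', z')"
    by (simp add: grad_x_eq algebra_simps sum.distrib scaleR_sum_right matrix_vector_right_distrib
        matrix_vector_mult_scaleR)
  also have "\<dots> = 0" using K by simp
  finally have "grad_x F (xs, r *\<^sub>R y + s *\<^sub>R y', r *\<^sub>R z + s *\<^sub>R z') = 0" .
  moreover have "(r *\<^sub>R y + s *\<^sub>R y') $ j * g xs $ j = r * (y $ j * g xs $ j) + s * (y' $ j * g xs $ j)" for j
    by (simp add: ring_distribs)
  then have "(r *\<^sub>R y + s *\<^sub>R y') $ j * g xs $ j = 0" for j using K(3,4) by simp
  moreover have "0 \<le> (r *\<^sub>R y + s *\<^sub>R y') $ j" for j using K(1,2) rs by simp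
  ultimately have "(xs, r *\<^sub>R y + s *\<^sub>R y', r *\<^sub>R z + s *\<^sub>R z') \<in> Saddle F"
    unfolding Saddle_iff_KKT using saddle_KKT by blast
  moreover have "r *\<^sub>R w + s *\<^sub>R v = (xs, r *\<^sub>R y + s *\<^sub>R y', r *\<^sub>R z + s *\<^sub>R z')"
    using rs(3) by (simp add: w v x flip: scaleR_add_left)
  ultimately show "r *\<^sub>R w + s *\<^sub>R v \<in> Saddle F" by simp
qed

end

section \<open>The Lyapunov function along a differentiable curve\<close>

context saddle_problem
begin

lemma Saddle_nonempty: "Saddle F \<noteq> {}"
  using saddle by blast

lemma V2_eq:
  "V2 F w = ((norm (grad_x F w))\<^sup>2 + (norm (A *v fst w - b))\<^sup>2
      + (\<Sum>j\<in>UNIV. active_square (g (fst w) $ j) (fst (snd w) $ j))) / 2 + (infdist w (Saddle F))\<^sup>2 / 2"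
proof (cases w)
  case (fields x y z)
  have "(\<Sum>j\<in>UNIV - index_set F w. (grad_y F w $ j)\<^sup>2) = (\<Sum>j\<in>UNIV. active_square (g x $ j) (y $ j))"
    by (rule sum.mono_neutral_cong_left)
       (auto simp: fields index_set_def grad_y_eq active_square_def)
  then show ?thesis by (simp add: V2_def fields grad_z_eq)
qed

lemma V2_nonneg: "0 \<le> V2 F w"
  by (auto simp: V2_eq active_square_def intro!: sum_nonneg add_nonneg_nonneg)

lemma V2_eq_0_iff: "V2 F w = 0 \<longleftrightarrow> w \<in> Saddle F"
proof
  assume "V2 F w = 0"
  moreover have "0 \<le> ((norm (grad_x F w))\<^sup>2 + (norm (A *v fst w - b))\<^sup>2
      + (\<Sum>j\<in>UNIV. active_square (g (fst w) $ j) (fst (snd w) $ j))) / 2"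
    by (auto simp: active_square_def intro!: sum_nonneg add_nonneg_nonneg)
  ultimately have "(infdist w (Saddle F))\<^sup>2 / 2 = 0"
    unfolding V2_eq by (subst (asm) add_nonneg_eq_0_iff) simp_all
  then have "infdist w (Saddle F) = 0" by simp
  then show "w \<in> Saddle F" using in_closed_iff_infdist_zero[OF closed_Saddle Saddle_nonempty] by blast
next
  assume w: "w \<in> Saddle F"
  obtain x y z where xyz: "w = (x, y, z)" by (cases w)
  have "active_square (g x $ j) (y $ j) = 0" for j
    using w unfolding xyz Saddle_iff_KKT active_square_def by (metis less_eq_real_def mult_eq_0_iff power_zero_numeral)
  then show "V2 F w = 0" using w by (simp add: V2_eq xyz) (simp add: Saddle_iff_KKT)
qed

text \<open>Write \<open>G\<close> for the gradient in \<open>x\<close>, \<open>r\<close> for the residual \<open>A x - b\<close> and \<open>p\<close> for the projected slope of \<open>y\<close>.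
  Differentiating the squared speed produces \<open>r \<bullet> A G\<close> and \<open>p\<^sub>j (G \<bullet> Dg\<^sub>j)\<close> twice with opposite signs,
  once from the motion of the multipliers inside \<open>G\<close> and once from the motion of \<open>x\<close> inside the
  constraints. Only the Hessian term survives. The domain \<open>{a..}\<close> serves both two-sided derivatives
  and, for \<open>t = a\<close>, right derivatives.\<close>

lemma V2_has_derivative_le_decay:
  assumes coord: "\<And>j. projected_coordinate a (\<lambda>s. g (fst (w s)) $ j) (\<lambda>s. fst (snd (w s)) $ j)"
    and "a \<le> t" and st: "w t \<in> state_space"
    and w': "(w has_vector_derivative saddle_field F (w t)) (at t within {a..})"
  shows "\<exists>D\<le>decay (w t). ((\<lambda>s. V2 F (w s)) has_real_derivative D) (at t within {a..})"
proof -
  obtain x y z where xyz: "w t = (x, y, z)" by (cases "w t")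
  define G where "G = grad_x F (x, y, z)"
  define r where "r = A *v x - b"
  define p where "p j = proj_plus (g x $ j) (y $ j)" for j
  have y: "0 \<le> y $ j" for j using st by (simp add: xyz state_space_def)
  note lin = bounded_linear.has_vector_derivative
  have X': "((\<lambda>s. fst (w s)) has_vector_derivative - G) (at t within {a..})"
    using lin[OF bounded_linear_fst w'] by (simp add: xyz saddle_field_eq G_def)
  have Y': "((\<lambda>s. fst (snd (w s)) $ j) has_vector_derivative p j) (at t within {a..})" for j
    using lin[OF bounded_linear_vec_nth lin[OF bounded_linear_fst lin[OF bounded_linear_snd w']]]
    by (simp add: xyz saddle_field_eq p_def proj_plus_vec_def)
  have Z': "((\<lambda>s. snd (snd (w s))) has_vector_derivative r) (at t within {a..})"
    using lin[OF bounded_linear_snd lin[OF bounded_linear_snd w']] by (simp add: xyz saddle_field_eq r_def)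
  have along_x: "((\<lambda>s. h (fst (w s))) has_vector_derivative h' (- G)) (at t within {a..})"
    if "(h has_derivative h') (at x)" for h :: "real ^ 'n \<Rightarrow> 'b::real_normed_vector" and h'
    using has_vector_derivative_compose_has_derivative[OF X'] that by (simp add: xyz)
  define E where "E = Hf x (- G) + (\<Sum>j\<in>UNIV. y $ j *\<^sub>R Hg j x (- G) + p j *\<^sub>R Dg j x) + transpose A *v r"
  have G': "((\<lambda>s. grad_x F (w s)) has_vector_derivative E) (at t within {a..})"
    unfolding grad_x_conv E_def
  proof (intro has_vector_derivative_add has_vector_derivative_sum)
    show "((\<lambda>s. Df (fst (w s))) has_vector_derivative Hf x (- G)) (at t within {a..})"
      by (rule along_x[OF Hf])
    show "((\<lambda>s. fst (snd (w s)) $ j *\<^sub>R Dg j (fst (w s))) has_vector_derivative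
        y $ j *\<^sub>R Hg j x (- G) + p j *\<^sub>R Dg j x) (at t within {a..})" for j
      using has_vector_derivative_scaleR[OF Y'[of j, folded has_real_derivative_iff_has_vector_derivative]
          along_x[OF Hg[of j]]] by (simp add: xyz)
    show "((\<lambda>s. transpose A *v snd (snd (w s))) has_vector_derivative transpose A *v r) (at t within {a..})"
      by (rule lin[OF matrix_vector_mul_bounded_linear Z'])
  qed
  have R': "((\<lambda>s. A *v fst (w s) - b) has_vector_derivative A *v (- G)) (at t within {a..})"
    using has_vector_derivative_diff[OF lin[OF matrix_vector_mul_bounded_linear X'] has_vector_derivative_const] by simp
  have S': "((\<lambda>s. active_square (g (fst (w s)) $ j) (fst (snd (w s)) $ j)) has_real_derivative
      2 * p j * ((- G) \<bullet> Dg j x)) (at t within {a..})" for j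
  proof -
    interpret projected_coordinate a "\<lambda>s. g (fst (w s)) $ j" "\<lambda>s. fst (snd (w s)) $ j" by (rule coord)
    have "((\<lambda>s. g (fst (w s)) $ j) has_real_derivative (- G) \<bullet> Dg j x) (at t within {a..})"
      using along_x[OF Dg[where j=j]] by (simp add: has_real_derivative_iff_has_vector_derivative)
    from active_square_has_derivative[OF \<open>a \<le> t\<close> this, unfolded xyz fst_conv snd_conv, OF Y'[of j, unfolded p_def]]
    have "((\<lambda>s. active_square (g (fst (w s)) $ j) (fst (snd (w s)) $ j)) has_real_derivative
        (if y $ j = 0 \<and> g x $ j < 0 then 0 else 2 * (g x $ j) * ((- G) \<bullet> Dg j x))) (at t within {a..})" .
    moreover have "(if y $ j = 0 \<and> g x $ j < 0 then 0 else 2 * (g x $ j) * ((- G) \<bullet> Dg j x)) = 2 * p j * ((- G) \<bullet> Dg j x)"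
      using y[of j] by (simp add: p_def proj_plus_eq)
    ultimately show ?thesis by (simp only:)
  qed
  have sum': "((\<lambda>s. \<Sum>j\<in>UNIV. active_square (g (fst (w s)) $ j) (fst (snd (w s)) $ j)) has_real_derivative
      (\<Sum>j\<in>UNIV. 2 * p j * ((- G) \<bullet> Dg j x))) (at t within {a..})"
    by (rule DERIV_sum) (rule S')
  let ?q = "closest_point (Saddle F) (w t)"
  have dist': "((\<lambda>s. (infdist (w s) (Saddle F))\<^sup>2 / 2) has_real_derivative (w t - ?q) \<bullet> saddle_field F (w t))
      (at t within {a..})"
    unfolding has_real_derivative_iff_has_vector_derivative
    by (rule has_vector_derivative_compose_has_derivative
        [OF w' has_derivative_half_infdist_squared[OF convex_Saddle closed_Saddle Saddle_nonempty]])
  have norm2: "((\<lambda>s. (norm (grad_x F (w s)))\<^sup>2) has_real_derivative 2 * (G \<bullet> E)) (at t within {a..})"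
    "((\<lambda>s. (norm (A *v fst (w s) - b))\<^sup>2) has_real_derivative 2 * (r \<bullet> (A *v (- G)))) (at t within {a..})"
    using has_real_derivative_norm_squared[OF G'] has_real_derivative_norm_squared[OF R']
    unfolding xyz fst_conv G_def[symmetric] r_def[symmetric] .
  define D where "D = (2 * (G \<bullet> E) + 2 * (r \<bullet> (A *v (- G))) + (\<Sum>j\<in>UNIV. 2 * p j * ((- G) \<bullet> Dg j x))) / 2
      + (w t - ?q) \<bullet> saddle_field F (w t)"
  have "((\<lambda>s. V2 F (w s)) has_real_derivative D) (at t within {a..})"
    unfolding V2_eq D_def
    by (rule DERIV_add[OF DERIV_cdivide[OF DERIV_add[OF DERIV_add[OF norm2] sum']] dist'])
  moreover have "D \<le> decay (w t)"
  proof -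
    have Hodd: "lagrangian_Hessian x y (- G) = - lagrangian_Hessian x y G"
      by (rule linear_neg[OF has_derivative_linear[OF grad_x_has_derivative_x]])
    have "E = - lagrangian_Hessian x y G + (\<Sum>j\<in>UNIV. p j *\<^sub>R Dg j x) + transpose A *v r"
      unfolding Hodd[symmetric] E_def by (simp add: lagrangian_Hessian_def sum.distrib)
    then have "2 * (G \<bullet> E) + 2 * (r \<bullet> (A *v (- G))) + (\<Sum>j\<in>UNIV. 2 * p j * ((- G) \<bullet> Dg j x))
        = - 2 * (G \<bullet> lagrangian_Hessian x y G)"
      unfolding inner_matrix_vector_transpose[where A=A]
      by (simp add: inner_add_right inner_diff_right inner_sum_right sum_distrib_left sum_negf mult.assoc)
    moreover have "c * (G \<bullet> G) \<le> G \<bullet> lagrangian_Hessian x y G" by (rule lagrangian_Hessian_ge[OF y])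
    moreover have "(w t - ?q) \<bullet> saddle_field F (w t) \<le> - c * ((x - xs) \<bullet> (x - xs)) + y \<bullet> g xs"
    proof -
      obtain x' y' z' where q: "?q = (x', y', z')" by (cases ?q)
      moreover have "?q \<in> Saddle F" using closest_point_in_set[OF closed_Saddle Saddle_nonempty] by blast
      ultimately have qS: "(x', y', z') \<in> Saddle F" by simp
      show ?thesis
        using saddle_field_dissipative[OF qS st[unfolded xyz]]
        unfolding Saddle_x_unique[OF qS] q unfolding xyz .
    qed
    ultimately show ?thesis by (simp add: D_def xyz G_def[symmetric] power2_norm_eq_inner)
  qed
  ultimately show ?thesis by blast
qed

end

section \<open>Trajectories\<close>

locale saddle_flow = saddle_problem f g A b F Df Hf Dg Hg c xs ys zs
  for f :: "real ^ 'n \<Rightarrow> real" and g :: "real ^ 'n \<Rightarrow> real ^ 'p" and A :: "real ^ 'n ^ 'm" and b F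
    and Df Hf Dg Hg c xs ys zs +
  fixes w :: "real \<Rightarrow> (real ^ 'n) \<times> (real ^ 'p) \<times> (real ^ 'm)"
  assumes trajectory: "saddle_trajectory F w"
begin

lemma in_state_space: "0 \<le> t \<Longrightarrow> w t \<in> state_space"
  using trajectory by (simp add: saddle_trajectory_def)

lemma derivative_off_negligible:
  obtains N where "negligible N"
    "\<And>t. \<lbrakk>0 \<le> t; t \<notin> N\<rbrakk> \<Longrightarrow> (w has_vector_derivative saddle_field F (w t)) (at t within {0..})"
  using trajectory unfolding saddle_trajectory_def AE_lebesgue_on_atLeast_iff by blast

lemma field_has_integral:
  assumes "0 \<le> s" "s \<le> t"
  shows "((\<lambda>r. saddle_field F (w r)) has_integral (w t - w s)) {s..t}"
proof -
  obtain N where N: "negligible N"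
    "\<And>t. \<lbrakk>0 \<le> t; t \<notin> N\<rbrakk> \<Longrightarrow> (w has_vector_derivative saddle_field F (w t)) (at t within {0..})"
    using derivative_off_negligible by blast
  have "absolutely_continuous_on_interval 0 t w"
    using trajectory assms by (simp add: saddle_trajectory_def)
  moreover have "{s..t} \<subseteq> {0..t}" using assms by auto
  ultimately have "absolutely_continuous_on_interval s t w"
    unfolding absolutely_continuous_on_interval_def by (meson order_trans)
  then show ?thesis using \<open>s \<le> t\<close> N(1)
  proof (rule absolutely_continuous_fundamental_theorem)
    show "(w has_vector_derivative saddle_field F (w r)) (at r within {s..t})" if "r \<in> {s..t} - N" for r
      using that assms by (intro has_vector_derivative_within_subset[OF N(2)]) auto
  qed
qed

lemma w_continuous: "continuous_on {0..} w"
  by (rule indefinite_integral_continuous_on_atLeast[OF field_has_integral]) auto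

lemma continuous_along:
  assumes "continuous_on UNIV h" "0 \<le> a"
  shows "continuous_on {a..} (\<lambda>t. h (w t))"
  by (rule continuous_on_compose2[OF assms(1) continuous_on_subset[OF w_continuous]]) (use assms(2) in auto)

lemma field_components:
  "fst (saddle_field F v) = - grad_x F v"
  "fst (snd (saddle_field F v)) $ j = proj_plus (g (fst v) $ j) (fst (snd v) $ j)"
  "snd (snd (saddle_field F v)) = A *v fst v - b"
  by (cases v; simp add: saddle_field_eq proj_plus_vec_def)+

lemma coordinate:
  assumes "0 \<le> a"
  shows "projected_coordinate a (\<lambda>s. g (fst (w s)) $ j) (\<lambda>s. fst (snd (w s)) $ j)"
proof
  have "continuous_on UNIV (\<lambda>v :: (real ^ 'n) \<times> (real ^ 'p) \<times> (real ^ 'm). g (fst v) $ j)"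
    by (intro continuous_intros continuous_on_compose2[OF continuous_gradients(3)]) auto
  then show "continuous_on {a..} (\<lambda>s. g (fst (w s)) $ j)" using assms by (rule continuous_along)
  show "0 \<le> fst (snd (w t)) $ j" if "a \<le> t" for t
    using in_state_space[of t] that assms by (auto simp: state_space_def)
  show "((\<lambda>r. proj_plus (g (fst (w r)) $ j) (fst (snd (w r)) $ j)) has_integral
      fst (snd (w t)) $ j - fst (snd (w s)) $ j) {s..t}" if "a \<le> s" "s \<le> t" for s t
  proof -
    have "bounded_linear (\<lambda>v :: (real ^ 'n) \<times> (real ^ 'p) \<times> (real ^ 'm). fst (snd v) $ j)"
      by (intro bounded_linear_compose[OF bounded_linear_vec_nth] bounded_linear_compose[OF bounded_linear_fst]
          bounded_linear_snd)
    from has_integral_linear[OF field_has_integral[of s t] this] show ?thesis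
      using that assms by (simp add: o_def field_components)
  qed
qed

lemma right_derivative:
  assumes "0 \<le> a"
  shows "(w has_vector_derivative saddle_field F (w a)) (at a within {a..})"
proof -
  have smooth: "((\<lambda>s. L (w s)) has_vector_derivative L (saddle_field F (w a))) (at a within {a..})"
    if "bounded_linear L" "continuous_on UNIV (\<lambda>v. L (saddle_field F v))"
    for L :: "(real ^ 'n) \<times> (real ^ 'p) \<times> (real ^ 'm) \<Rightarrow> 'c::banach"
  proof (rule indefinite_integral_has_vector_derivative)
    interpret L: bounded_linear L by fact
    show "((\<lambda>r. L (saddle_field F (w r))) has_integral L (w s) - L (w a)) {a..s}" if "a \<le> s" for s
      using has_integral_linear[OF field_has_integral[OF assms that] \<open>bounded_linear L\<close>]
      by (simp add: o_def L.diff)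
    show "continuous (at a within {a..}) (\<lambda>r. L (saddle_field F (w r)))"
      using continuous_along[OF that(2) assms] by (simp add: continuous_on_eq_continuous_within)
  qed simp
  have "((\<lambda>s. fst (w s)) has_vector_derivative fst (saddle_field F (w a))) (at a within {a..})"
    by (rule smooth[OF bounded_linear_fst])
       (auto simp: field_components intro!: continuous_intros continuous_grad_x)
  moreover have "((\<lambda>s. fst (snd (w s))) has_vector_derivative fst (snd (saddle_field F (w a)))) (at a within {a..})"
    using projected_coordinate.right_derivative[OF coordinate[OF assms]]
    by (intro has_vector_derivative_vecI) (simp add: field_components)
  moreover have "((\<lambda>s. snd (snd (w s))) has_vector_derivative snd (snd (saddle_field F (w a)))) (at a within {a..})"
    by (rule smooth[OF bounded_linear_compose[OF bounded_linear_snd bounded_linear_snd]])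
       (auto simp: field_components intro!: continuous_intros
          linear_continuous_on_compose[OF _ matrix_vector_mul_linear])
  ultimately have "((\<lambda>s. (fst (w s), fst (snd (w s)), snd (snd (w s)))) has_vector_derivative
      (fst (saddle_field F (w a)), fst (snd (saddle_field F (w a))), snd (snd (saddle_field F (w a))))) (at a within {a..})"
    by (intro has_vector_derivative_Pair)
  then show ?thesis by simp
qed

lemma V2_right_derivative:
  assumes "0 \<le> t"
  shows "\<exists>D\<le>decay (w t). ((\<lambda>s. V2 F (w s)) has_real_derivative D) (at t within {t..})"
  by (rule V2_has_derivative_le_decay[OF coordinate[OF assms] order_refl in_state_space[OF assms]
        right_derivative[OF assms]])

lemma V2_differentiable_AE:
  "AE t in lebesgue_on {0..}. (\<lambda>s. V2 F (w s)) differentiable (at t within {0..})"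
proof -
  obtain N where N: "negligible N"
    "\<And>t. \<lbrakk>0 \<le> t; t \<notin> N\<rbrakk> \<Longrightarrow> (w has_vector_derivative saddle_field F (w t)) (at t within {0..})"
    using derivative_off_negligible by blast
  have "(\<lambda>s. V2 F (w s)) differentiable (at t within {0..})" if "0 \<le> t" "t \<notin> N" for t
    using V2_has_derivative_le_decay[OF coordinate[OF order_refl] that(1) in_state_space[OF that(1)] N(2)[OF that]]
    by (auto simp: has_field_derivative_def differentiable_def)
  then show ?thesis unfolding AE_lebesgue_on_atLeast_iff using N(1) by blast
qed

text \<open>Any derivative coincides with the right derivative, which exists at every time and obeys the bound.\<close>

lemma V2_derivative_le_decay:
  assumes "0 \<le> t" "((\<lambda>s. V2 F (w s)) has_real_derivative D) (at t within {0..})"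
  shows "D \<le> decay (w t)"
proof -
  obtain D' where D': "D' \<le> decay (w t)" "((\<lambda>s. V2 F (w s)) has_real_derivative D') (at t within {t..})"
    using V2_right_derivative[OF assms(1)] by blast
  have "((\<lambda>s. V2 F (w s)) has_real_derivative D) (at t within {t..})"
    by (rule DERIV_subset[OF assms(2)]) (use assms(1) in auto)
  moreover have "at t within {t..} \<noteq> bot" by (simp add: at_within_Ici_at_right)
  ultimately have "D = D'"
    using D'(2) vector_derivative_unique_within unfolding has_real_derivative_iff_has_vector_derivative by blast
  then show ?thesis using D'(1) by simp
qed

lemma decay_neg: "\<lbrakk>0 \<le> t; w t \<notin> Saddle F\<rbrakk> \<Longrightarrow> decay (w t) < 0"
  using decay_nonpos[OF in_state_space] decay_eq_0_iff[OF in_state_space] by (metis less_eq_real_def)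

text \<open>The derivatives themselves need not be continuous in time, but they are dominated by the continuous
  function \<open>decay \<circ> w\<close>.\<close>

lemma V2_limsup_derivative:
  assumes "0 \<le> t" "w t \<notin> Saddle F" "\<And>k::nat. 0 \<le> \<tau> k" "\<tau> \<longlonglongrightarrow> t"
    and D: "\<And>k. ((\<lambda>s. V2 F (w s)) has_real_derivative D k) (at (\<tau> k) within {0..})"
  shows "limsup (\<lambda>k. ereal (D k)) < 0"
proof -
  have "(\<lambda>k. decay (w (\<tau> k))) \<longlonglongrightarrow> decay (w t)"
    by (rule continuous_on_tendsto_compose[OF continuous_along[OF continuous_decay order_refl] assms(4)])
       (use assms in auto)
  then have "(\<lambda>k. ereal (decay (w (\<tau> k)))) \<longlonglongrightarrow> ereal (decay (w t))" by simp
  then have "limsup (\<lambda>k. ereal (decay (w (\<tau> k)))) = ereal (decay (w t))"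
    by (rule lim_imp_Limsup[OF sequentially_bot])
  moreover have "limsup (\<lambda>k. ereal (D k)) \<le> limsup (\<lambda>k. ereal (decay (w (\<tau> k))))"
    using V2_derivative_le_decay[OF assms(3) D] by (intro Limsup_mono) simp
  ultimately show ?thesis using decay_neg[OF assms(1,2)] by (metis ereal_less(2) le_less_trans ereal_less_eq(3) less_ereal.simps(1) zero_ereal_def)
qed

lemma V2_right_continuous:
  assumes "0 \<le> t"
  shows "continuous (at t within {t..}) (\<lambda>s. V2 F (w s))"
  using V2_right_derivative[OF assms] DERIV_continuous by blast

lemma V2_left_limit:
  assumes "0 < t"
  shows "\<exists>L. ((\<lambda>s. V2 F (w s)) \<longlongrightarrow> L) (at_left t) \<and> V2 F (w t) \<le> L"
proof -
  have "at_left t \<le> at t within {0..}" by (rule at_left_le_at_within_atLeast[OF assms])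
  then have w_lim: "((\<lambda>s. h (w s)) \<longlongrightarrow> h (w t)) (at_left t)" if "continuous_on UNIV h"
    for h :: "(real ^ 'n) \<times> (real ^ 'p) \<times> (real ^ 'm) \<Rightarrow> 'c::topological_space"
    using continuous_along[OF that order_refl] assms
    by (meson atLeast_iff continuous_on_def less_imp_le tendsto_mono)
  have "\<exists>L. ((\<lambda>s. active_square (g (fst (w s)) $ j) (fst (snd (w s)) $ j)) \<longlongrightarrow> L) (at_left t) \<and>
      active_square (g (fst (w t)) $ j) (fst (snd (w t)) $ j) \<le> L" for j
    by (rule projected_coordinate.active_square_left_limit[OF coordinate[OF order_refl] assms])
  from choice[OF allI[OF this]] obtain L where
    "\<forall>j. ((\<lambda>s. active_square (g (fst (w s)) $ j) (fst (snd (w s)) $ j)) \<longlongrightarrow> L j) (at_left t) \<and>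
      active_square (g (fst (w t)) $ j) (fst (snd (w t)) $ j) \<le> L j"
    by (rule exE)
  then have L: "((\<lambda>s. active_square (g (fst (w s)) $ j) (fst (snd (w s)) $ j)) \<longlongrightarrow> L j) (at_left t)"
    "active_square (g (fst (w t)) $ j) (fst (snd (w t)) $ j) \<le> L j" for j
    by blast+
  have "continuous_on UNIV (\<lambda>v::(real ^ 'n) \<times> (real ^ 'p) \<times> (real ^ 'm). A *v fst v - b)"
    by (rule continuous_on_diff[OF linear_continuous_on_compose
        [OF continuous_on_fst[OF continuous_on_id] matrix_vector_mul_linear] continuous_on_const])
  note lims = w_lim[OF continuous_grad_x] w_lim[OF this] w_lim[OF continuous_on_infdist[OF continuous_on_id]]
  have "((\<lambda>s. V2 F (w s)) \<longlongrightarrow> ((norm (grad_x F (w t)))\<^sup>2 + (norm (A *v fst (w t) - b))\<^sup>2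
      + (\<Sum>j\<in>UNIV. L j)) / 2 + (infdist (w t) (Saddle F))\<^sup>2 / 2) (at_left t)"
    unfolding V2_eq by (intro tendsto_add tendsto_divide tendsto_power tendsto_norm tendsto_sum tendsto_const lims L(1)) simp_all
  moreover have "V2 F (w t) \<le> ((norm (grad_x F (w t)))\<^sup>2 + (norm (A *v fst (w t) - b))\<^sup>2
      + (\<Sum>j\<in>UNIV. L j)) / 2 + (infdist (w t) (Saddle F))\<^sup>2 / 2"
    unfolding V2_eq by (intro add_right_mono divide_right_mono add_left_mono sum_mono L(2)) simp
  ultimately show ?thesis by blast
qed

lemma V2_discontinuity:
  assumes "0 \<le> t" "\<not> continuous (at t within {0..}) (\<lambda>s. V2 F (w s))"
  shows "\<exists>L. ((\<lambda>s. V2 F (w s)) \<longlongrightarrow> L) (at t within {0..<t}) \<and> V2 F (w t) \<le> L"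
proof -
  have "t \<noteq> 0" using assms V2_right_continuous by auto
  then have "0 < t" using assms(1) by simp
  then show ?thesis using V2_left_limit by (simp only: at_within_atLeastLessThan_eq_at_left)
qed

lemma distance_to_saddle_antimono:
  assumes q: "q \<in> Saddle F" and "0 \<le> s" "s \<le> t"
  shows "dist (w t) q \<le> dist (w s) q"
proof -
  have deriv: "\<exists>D\<le>0. ((\<lambda>s. (norm (w s - q))\<^sup>2) has_real_derivative D) (at r within {r..})" if "0 \<le> r" for r
  proof (intro exI conjI)
    have "((\<lambda>s. w s - q) has_vector_derivative saddle_field F (w r)) (at r within {r..})"
      using has_vector_derivative_diff[OF right_derivative[OF that] has_vector_derivative_const] by simp
    then show "((\<lambda>s. (norm (w s - q))\<^sup>2) has_real_derivative 2 * ((w r - q) \<bullet> saddle_field F (w r))) (at r within {r..})"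
      by (rule has_real_derivative_norm_squared)
    obtain x' y' z' where q': "q = (x', y', z')" by (cases q)
    obtain x y z where wr: "w r = (x, y, z)" by (cases "w r")
    have st: "(x, y, z) \<in> state_space" using in_state_space[OF that] wr by simp
    have "(w r - q) \<bullet> saddle_field F (w r) \<le> - c * ((x - xs) \<bullet> (x - xs)) + y \<bullet> g xs"
      using saddle_field_dissipative[OF q[unfolded q'] st] Saddle_x_unique[OF q[unfolded q']] by (simp add: q' wr)
    also have "\<dots> \<le> 0"
      using inner_constraint_nonpos[OF st] mult_nonneg_nonneg[OF less_imp_le[OF c_pos] inner_ge_zero[of "x - xs"]]
      by simp
    finally show "2 * ((w r - q) \<bullet> saddle_field F (w r)) \<le> 0" by simp
  qed
  have "(norm (w t - q))\<^sup>2 - (norm (w s - q))\<^sup>2 \<le> 0 * (t - s)"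
  proof (rule growth_bound_right_derivative[OF \<open>s \<le> t\<close>])
    show "\<exists>D\<le>0. ((\<lambda>s. (norm (w s - q))\<^sup>2) has_real_derivative D) (at r within {r..})" if "s \<le> r" "r < t" for r
      using deriv that \<open>0 \<le> s\<close> by simp
    show "\<exists>L. ((\<lambda>s. (norm (w s - q))\<^sup>2) \<longlongrightarrow> L) (at_left r) \<and> (norm (w r - q))\<^sup>2 \<le> L" if "s < r" "r \<le> t" for r
    proof (intro exI conjI)
      have "continuous_on {0..} (\<lambda>s. (norm (w s - q))\<^sup>2)" by (intro continuous_intros w_continuous)
      then have "((\<lambda>s. (norm (w s - q))\<^sup>2) \<longlongrightarrow> (norm (w r - q))\<^sup>2) (at r within {0..})"
        using that \<open>0 \<le> s\<close> by (simp add: continuous_on_def)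
      moreover have "at_left r \<le> at r within {0..}"
        by (rule at_left_le_at_within_atLeast) (use that \<open>0 \<le> s\<close> in auto)
      ultimately show "((\<lambda>s. (norm (w s - q))\<^sup>2) \<longlongrightarrow> (norm (w r - q))\<^sup>2) (at_left r)"
        by (rule tendsto_mono[rotated])
    qed (rule order_refl)
  qed
  then show ?thesis by (simp add: dist_norm)
qed

text \<open>Follow the saddle point nearest to the initial state.\<close>

lemma infdist_le_initial:
  assumes "0 \<le> t"
  shows "infdist (w t) (Saddle F) \<le> infdist (w 0) (Saddle F)"
proof -
  let ?q = "closest_point (Saddle F) (w 0)"
  have q: "?q \<in> Saddle F" by (rule closest_point_in_set[OF closed_Saddle Saddle_nonempty])
  have "infdist (w t) (Saddle F) \<le> dist (w t) ?q" by (rule infdist_le[OF q])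
  also have "\<dots> \<le> dist (w 0) ?q" by (rule distance_to_saddle_antimono[OF q order_refl assms])
  also have "\<dots> = infdist (w 0) (Saddle F)"
    by (simp add: infdist_eq_setdist setdist_closest_point[OF closed_Saddle Saddle_nonempty])
  finally show ?thesis .
qed

text \<open>Otherwise \<^const>\<open>V2\<close> would decrease at least linearly and become negative.\<close>

lemma decay_not_bounded_away:
  assumes "0 \<le> T" "0 < \<eta>"
  shows "\<exists>t\<ge>T. - \<eta> < decay (w t)"
proof (rule ccontr)
  assume "\<not> ?thesis"
  then have decay: "decay (w t) \<le> - \<eta>" if "T \<le> t" for t using that by fastforce
  \<comment> \<open>the time after which a decrease at rate \<open>\<eta>\<close> has used up more than \<open>V2 F (w T)\<close>\<close>
  define t where "t = T + (V2 F (w T) + 1) / \<eta>"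
  have "T \<le> t" using assms V2_nonneg[of "w T"] by (simp add: t_def)
  have "V2 F (w t) - V2 F (w T) \<le> - \<eta> * (t - T)"
  proof (rule growth_bound_right_derivative[OF \<open>T \<le> t\<close>])
    show "\<exists>D\<le>- \<eta>. ((\<lambda>s. V2 F (w s)) has_real_derivative D) (at r within {r..})" if "T \<le> r" for r
      using V2_right_derivative[of r] decay[OF that] that assms(1) by (meson order_trans)
    show "\<exists>L. ((\<lambda>s. V2 F (w s)) \<longlongrightarrow> L) (at_left r) \<and> V2 F (w r) \<le> L" if "T < r" for r
      using V2_left_limit[of r] that assms(1) by simp
  qed
  also have "- \<eta> * (t - T) = - (V2 F (w T) + 1)" using assms(2) by (simp add: t_def)
  finally show False using V2_nonneg[of "w t"] by simp
qed

text \<open>A sequence of times along which \<open>decay\<close> tends to \<open>0\<close> has, by boundedness of the trajectory, a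
  subsequence along which \<open>w\<close> converges to a zero of \<open>decay\<close>, that is, to a saddle point \<open>q\<close>.
  Monotonicity of the distance to \<open>q\<close> extends this to all times.\<close>

lemma converges_to_saddle: "\<exists>q\<in>Saddle F. (w \<longlongrightarrow> q) at_top"
proof -
  have "\<exists>t\<ge>real k. - inverse (real (Suc k)) < decay (w t)" for k
    by (rule decay_not_bounded_away) auto
  then obtain \<tau> where \<tau>: "\<And>k. real k \<le> \<tau> k" "\<And>k. - inverse (real (Suc k)) < decay (w (\<tau> k))"
    by metis
  have \<tau>0: "0 \<le> \<tau> k" for k using \<tau>(1)[of k] by simp
  have "w (\<tau> k) \<in> cball (xs, ys, zs) (dist (w 0) (xs, ys, zs))" for k
    using distance_to_saddle_antimono[OF saddle order_refl \<tau>0] by (simp add: dist_commute)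
  then obtain q \<rho> where \<rho>: "strict_mono (\<rho> :: nat \<Rightarrow> nat)" and lim: "((w \<circ> \<tau>) \<circ> \<rho>) \<longlonglongrightarrow> q"
    using compact_cball[of "(xs, ys, zs)" "dist (w 0) (xs, ys, zs)"] unfolding compact_def
    by (metis comp_apply)
  have lim': "(\<lambda>k. w (\<tau> (\<rho> k))) \<longlonglongrightarrow> q" using lim by (simp add: o_def)
  have st: "q \<in> state_space"
    by (rule closed_sequentially[OF closed_state_space _ lim']) (simp add: in_state_space \<tau>0)
  have "(\<lambda>k. decay (w (\<tau> (\<rho> k)))) \<longlonglongrightarrow> decay q"
    by (rule continuous_on_tendsto_compose[OF continuous_decay lim']) auto
  moreover have "(\<lambda>k. - inverse (real (Suc (\<rho> k)))) \<longlonglongrightarrow> - 0"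
    by (intro tendsto_minus LIMSEQ_subseq_LIMSEQ[OF LIMSEQ_inverse_real_of_nat \<rho>, unfolded o_def])
  ultimately have "- 0 \<le> decay q"
    using \<tau>(2) by (intro LIMSEQ_le[of _ "- 0" _ "decay q"]) (auto intro: less_imp_le)
  then have q: "q \<in> Saddle F" using decay_nonpos[OF st] decay_eq_0_iff[OF st] by simp
  have "(w \<longlongrightarrow> q) at_top"
  proof (rule tendstoI)
    fix e :: real assume "0 < e"
    then have "\<forall>\<^sub>F k in sequentially. dist (w (\<tau> (\<rho> k))) q < e" by (rule tendstoD[OF lim'])
    then obtain k where k: "dist (w (\<tau> (\<rho> k))) q < e" by (auto simp: eventually_sequentially)
    have "dist (w t) q < e" if "\<tau> (\<rho> k) \<le> t" for t
      using distance_to_saddle_antimono[OF q \<tau>0 that] k by (rule le_less_trans)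
    then show "\<forall>\<^sub>F t in at_top. dist (w t) q < e" by (auto simp: eventually_at_top_linorder)
  qed
  then show ?thesis using q by blast
qed

end

section \<open>The Lyapunov theorem\<close>

theorem theorem5p1:
  fixes f :: "real ^ 'n \<Rightarrow> real"
    and g :: "real ^ 'n \<Rightarrow> real ^ 'p"
    and A :: "real ^ 'n ^ 'm"
    and b :: "real ^ 'm"
    and F :: "(real ^ 'n) \<times> (real ^ 'p) \<times> (real ^ 'm) \<Rightarrow> real"
  assumes F_def: "F = lagrangian f g A b"
    and f_C2: "twice_continuously_differentiable f"
    and f_strongly_convex: "strongly_convex f"
    and g_C2: "twice_continuously_differentiable g"
    and g_convex: "\<And>j. convex_on UNIV (\<lambda>x. g x $ j)"
    and saddle_nonempty: "Saddle F \<noteq> {}"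
  shows "(\<forall>w\<in>state_space. V2 F w \<ge> 0 \<and> (V2 F w = 0 \<longleftrightarrow> w \<in> Saddle F)) \<and>
    (\<forall>w. saddle_trajectory F w \<longrightarrow>
       (AE t in lebesgue_on {0..}. (\<lambda>s. V2 F (w s)) differentiable (at t within {0..})) \<and>
       (\<forall>t\<ge>0. w t \<notin> Saddle F \<longrightarrow>
          (\<forall>D. ((\<lambda>s. V2 F (w s)) has_real_derivative D) (at t within {0..}) \<longrightarrow> D < 0) \<and>
          (\<forall>\<tau> D. (\<forall>k::nat. \<tau> k \<ge> 0) \<and> \<tau> \<longlonglongrightarrow> t \<and>
             (\<forall>k. ((\<lambda>s. V2 F (w s)) has_real_derivative D k) (at (\<tau> k) within {0..})) \<longrightarrow>
             limsup (\<lambda>k. ereal (D k)) < 0)) \<and>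
       (\<forall>t\<ge>0. continuous (at_right t) (\<lambda>s. V2 F (w s))) \<and>
       (\<forall>t\<ge>0. \<not> continuous (at t within {0..}) (\<lambda>s. V2 F (w s)) \<longrightarrow>
          (\<exists>L. ((\<lambda>s. V2 F (w s)) \<longlongrightarrow> L) (at t within {0..<t}) \<and> V2 F (w t) \<le> L))) \<and>
    globally_asymptotically_stable {w. saddle_trajectory F w} (Saddle F) \<and>
    (\<forall>w. saddle_trajectory F w \<longrightarrow> (\<exists>q\<in>Saddle F. (w \<longlongrightarrow> q) at_top))"
proof -
  obtain Df Hf where f1: "\<And>x. ((\<lambda>x. f x \<bullet> 1) has_derivative (\<lambda>k. k \<bullet> Df x)) (at x)"
    and Hf: "\<And>x. (Df has_derivative Hf x) (at x)"
    using twice_continuously_differentiable_gradient[OF f_C2] by blast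
  have Df: "(f has_derivative (\<lambda>k. k \<bullet> Df x)) (at x)" for x using f1[of x] by simp
  obtain c where c: "c > 0" "\<And>x v. c * (v \<bullet> v) \<le> v \<bullet> Hf x v"
    using strongly_convex_Hessian_ge[OF f_strongly_convex Df Hf] by blast
  have "\<exists>DH. (\<forall>x. ((\<lambda>x. g x $ j) has_derivative (\<lambda>k. k \<bullet> fst DH x)) (at x))
      \<and> (\<forall>x. (fst DH has_derivative snd DH x) (at x))" for j
  proof -
    obtain D H where "\<And>x. ((\<lambda>x. g x \<bullet> axis j 1) has_derivative (\<lambda>k. k \<bullet> D x)) (at x)"
      "\<And>x. (D has_derivative H x) (at x)"
      using twice_continuously_differentiable_gradient[OF g_C2] by blast
    then show ?thesis by (intro exI[of _ "(D, H)"]) (simp add: inner_axis)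
  qed
  from choice[OF allI[OF this]] obtain DH where
    "\<forall>j. (\<forall>x. ((\<lambda>x. g x $ j) has_derivative (\<lambda>k. k \<bullet> fst (DH j) x)) (at x))
      \<and> (\<forall>x. (fst (DH j) has_derivative snd (DH j) x) (at x))"
    by (rule exE)
  then have Dg: "((\<lambda>x. g x $ j) has_derivative (\<lambda>k. k \<bullet> fst (DH j) x)) (at x)"
    and Hg: "(fst (DH j) has_derivative snd (DH j) x) (at x)" for j x
    by blast+
  have Hg_ge: "0 \<le> v \<bullet> snd (DH j) x v" for j x v
    by (rule convex_imp_Hessian_nonneg[OF g_convex Dg Hg])
  obtain xs ys zs where saddle: "(xs, ys, zs) \<in> Saddle F"
    using saddle_nonempty by auto
  interpret saddle_problem f g A b F Df Hf "\<lambda>j. fst (DH j)" "\<lambda>j. snd (DH j)" c xs ys zs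
    by unfold_locales (rule F_def Df Hf Dg Hg c Hg_ge saddle)+
  have flow: "saddle_flow f g A b F Df Hf (\<lambda>j. fst (DH j)) (\<lambda>j. snd (DH j)) c xs ys zs w"
    if "saddle_trajectory F w" for w
    by unfold_locales (rule that)
  have right: "continuous (at_right t) (\<lambda>s. V2 F (w s))" if "saddle_trajectory F w" "0 \<le> t" for w t
    using saddle_flow.V2_right_continuous[OF flow[OF that(1)] that(2)]
    by (simp add: at_within_Ici_at_right)
  have negative: "D < 0"
    if "saddle_trajectory F w" "0 \<le> t" "w t \<notin> Saddle F"
      "((\<lambda>s. V2 F (w s)) has_real_derivative D) (at t within {0..})" for w t D
    using saddle_flow.V2_derivative_le_decay[OF flow[OF that(1)] that(2,4)]
      saddle_flow.decay_neg[OF flow[OF that(1)] that(2,3)] by (rule le_less_trans)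
  have converges: "\<exists>q\<in>Saddle F. (w \<longlongrightarrow> q) at_top" if "saddle_trajectory F w" for w
    by (rule saddle_flow.converges_to_saddle[OF flow[OF that]])
  have attractive: "((\<lambda>t. infdist (w t) (Saddle F)) \<longlongrightarrow> 0) at_top" if "saddle_trajectory F w" for w
  proof -
    obtain q where q: "q \<in> Saddle F" "(w \<longlongrightarrow> q) at_top" using converges[OF \<open>saddle_trajectory F w\<close>] by blast
    have "((\<lambda>t. infdist (w t) (Saddle F)) \<longlongrightarrow> infdist q (Saddle F)) at_top"
      by (rule tendsto_infdist[OF q(2)])
    then show ?thesis using q(1) by simp
  qed
  have "globally_asymptotically_stable {w. saddle_trajectory F w} (Saddle F)"
    unfolding globally_asymptotically_stable_def stable_set_def globally_attractive_def
    using saddle_flow.infdist_le_initial[OF flow] attractive by (blast intro: le_less_trans)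
  moreover have "V2 F w \<ge> 0 \<and> (V2 F w = 0 \<longleftrightarrow> w \<in> Saddle F)" for w
    using V2_nonneg V2_eq_0_iff by blast
  ultimately show ?thesis
    using saddle_flow.V2_differentiable_AE[OF flow] negative saddle_flow.V2_limsup_derivative[OF flow]
      right saddle_flow.V2_discontinuity[OF flow] converges
    by (intro conjI ballI allI impI) (blast | (elim conjE, blast))+
qed

end
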